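(* Let $\mathsf X,\mathsf U$ be compact, let $Q\in\mathcal M(\mathsf X|\mathsf X\times\mathsf U)$ be weakly continuous (i.e. $Qf\in C_b(\mathsf X\times\mathsf U)$ for all $f\in C_b(\mathsf X)$), let $c:\mathsf X\times\mathsf U\to[0,\infty)$ be lower semicontinuous and bounded, with $C=\sup_{x,u}c(x,u)$, let $0<\beta<1$, and let $\mu,\pi\in\mathcal P(\mathsf X)$. Given $R\ge0$ and $\varepsilon>0$, set $$\bar R=\bar R(\varepsilon,\beta)=\frac{(1-\beta)^2\varepsilon}{C}R,$$ and suppose there exist a function $h=h^\beta_{\mu,\pi}\in L^1(\pi)$, a constant $\lambda=\lambda^\beta_{\mu,\pi}>0$ and a kernel $\Phi^*\in\mathcal K^\beta_{\mu,\pi}(\bar R)$ such that $$\frac1{1-\beta}\langle\pi,h\rangle-\langle\mu,h\rangle+\lambda=\frac1{1-\beta}\langle\pi\otimes\Phi^*,c+\beta Qh\rangle=\frac1{1-\beta}D_\pi(\bar R;c+\beta Qh).$$ Let $\mathcal Q_\mu(R)$ be the set of all MRQ control laws $\mathbf\Phi=\{\Phi_t\}_{t\ge0}$ satisfying $I(\mu_t,\Phi_t)\le R$ for all $t\ge0$, where $\mu_t=\mathbb P^{\mathbf\Phi}_\mu(X_t\in\cdot)$. Then $$\inf_{\mathbf\Phi\in\mathcal Q_\mu(R)}J^\beta_\mu(\mathbf\Phi)\le\frac1{1-\beta}\left[D_\pi\big(\bar R(\varepsilon,\beta);c+\beta Qh\big)-\langle\pi,h\rangle\right]+\langle\mu,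h\rangle+\varepsilon.$$
   Context: All spaces are standard Borel. $\mathcal P(\mathsf X)$ is the set of Borel probability measures, $C_b$ the bounded continuous functions, $\mathcal M(\mathsf Y|\mathsf X)$ the Markov kernels from $\mathsf X$ to $\mathsf Y$; $\langle\mu,f\rangle=\int f\,d\mu$; $\mu K(B)=\int K(B|x)\mu(dx)$; $(\mu\otimes K)(A\times B)=\int_AK(B|x)\mu(dx)$; $Qh(x,u)=\int h(y)Q(dy|x,u)$. Relative entropy: $D(\mu\|\nu)=\langle\mu,\log\frac{d\mu}{d\nu}\rangle$ if $\mu\ll\nu$, $+\infty$ otherwise. Mutual information: $I(\mu,K)=D(\mu\otimes K\|\mu\otimes\mu K)$, where the second argument is the product measure. A sequence $\mathbf\Phi=\{\Phi_t\}_{t=0}^\infty$ with $\Phi_t\in\mathcal M(\mathsf U|\mathsf X)$ is a Markov randomized control law; $\mathbb P^{\mathbf\Phi}_\mu$, $\mathbb E^{\mathbf\Phi}_\mu$ refer to the process with $X_0\sim\mu$, $U_t\sim\Phi_t(\cdot|X_t)$, $X_{t+1}\sim Q(\cdot|X_t,U_t)$ (Markov). It is Markov randomized quasistationary (MRQ) if there are $\Phi^{(0)},\Phi^{(1)}\in\mathcal M(\mathsf U|\mathsf X)$ and a deterministic $t_0\in\{0,1,2,\dots\}$ with $\Phi_t=\Phi^{(0)}$ for $t<t_0$ and $\Phi_t=\Phi^{(1)}$ for $t\ge t_0$. Discounted cost: $J^\beta_\mu(\mathbf\Phi)=\mathbb E^{\mathbf\Phi}_\mu[\sum_{t=0}^\infty\beta^tc(X_t,U_t)]$.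 $Q_\Phi(A|x)=\int Q(A|x,u)\Phi(du|x)$; $\mathcal K^\beta_{\mu,\pi}=\{\Phi\in\mathcal M(\mathsf U|\mathsf X):\pi=(1-\beta)\mu+\beta\pi Q_\Phi\}$; $\mathcal I_\pi(R)=\{\Phi: I(\pi,\Phi)\le R\}$; $\mathcal K^\beta_{\mu,\pi}(R)=\mathcal K^\beta_{\mu,\pi}\cap\mathcal I_\pi(R)$; $D_\pi(R;f)=\inf_{\Phi\in\mathcal I_\pi(R)}\langle\pi\otimes\Phi,f\rangle$ (infimum over those $\Phi$ for which the integral is well defined). *)

theory Defs
  imports "HOL-Probability.Probability"
begin

section \<open>Measures, kernels and extended integrals\<close>

text \<open>Spaces are types of class \<open>polish_space\<close> with their Borel sigma-algebra.\<close>

abbreviation prob_measures :: "'a::topological_space measure set" where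
  "prob_measures \<equiv> space (prob_algebra borel)"

abbreviation markov_kernels :: "('a::topological_space \<Rightarrow> 'b::topological_space measure) set" where
  "markov_kernels \<equiv> borel \<rightarrow>\<^sub>M prob_algebra borel"

definition integral_defined :: "'a measure \<Rightarrow> ('a \<Rightarrow> ereal) \<Rightarrow> bool" where
  "integral_defined M f \<longleftrightarrow> f \<in> borel_measurable M \<and>
     ((\<integral>\<^sup>+ x. e2ennreal (f x) \<partial>M) < \<infinity> \<or> (\<integral>\<^sup>+ x. e2ennreal (- f x) \<partial>M) < \<infinity>)"

text \<open>
  The extended integral, positive part minus negative part. Where it is not well defined it
  takes the dummy value \<open>\<infinity>\<close>. In \<open>ereal\<close> the sum \<open>\<infinity> + a\<close> is \<open>\<infinity>\<close> for every \<open>a\<close>, so an integrand that is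
  itself undefined on a set of positive measure has integral \<open>\<infinity>\<close>; such an integral is never equal
  to a real number and never affects an infimum.
\<close>
definition ext_integral :: "'a measure \<Rightarrow> ('a \<Rightarrow> ereal) \<Rightarrow> ereal" where
  "ext_integral M f =
     (if integral_defined M f
      then enn2ereal (\<integral>\<^sup>+ x. e2ennreal (f x) \<partial>M) - enn2ereal (\<integral>\<^sup>+ x. e2ennreal (- f x) \<partial>M)
      else \<infinity>)"

text \<open>The joint law \<open>\<mu> \<otimes> K\<close>; the output law \<open>\<mu>K\<close> is the monadic bind \<open>\<mu> \<bind> K\<close>.\<close>
definition joint_law ::
  "'a::topological_space measure \<Rightarrow> ('a \<Rightarrow> 'b::topological_space measure) \<Rightarrow> ('a \<times> 'b) measure" where
  "joint_law \<mu> K = \<mu> \<bind> (\<lambda>x. distr (K x) (borel \<Otimes>\<^sub>M borel) (Pair x))"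

definition kernel_apply :: "('a \<Rightarrow> 'b measure) \<Rightarrow> ('b \<Rightarrow> real) \<Rightarrow> 'a \<Rightarrow> ereal" where
  "kernel_apply K h p = ext_integral (K p) (\<lambda>y. ereal (h y))"

definition weakly_continuous ::
  "('a::topological_space \<Rightarrow> 'b::topological_space measure) \<Rightarrow> bool" where
  "weakly_continuous K \<longleftrightarrow>
     (\<forall>f :: 'b \<Rightarrow> real. f \<in> bcontfun \<longrightarrow> (\<lambda>p. \<integral>y. f y \<partial>K p) \<in> bcontfun)"

definition lower_semicontinuous :: "('a::topological_space \<Rightarrow> real) \<Rightarrow> bool" where
  "lower_semicontinuous f \<longleftrightarrow> (\<forall>a. open {x. a < f x})"

section \<open>Information\<close>

text \<open>
  Natural logarithm. \<open>KL_divergence\<close> is the corresponding Bochner integral, hence real-valued;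
  the extended integral gives \<open>\<infinity>\<close> where the log-density is not integrable.
\<close>
definition relative_entropy :: "'a measure \<Rightarrow> 'a measure \<Rightarrow> ereal" where
  "relative_entropy \<mu> \<nu> =
     (if absolutely_continuous \<nu> \<mu>
      then ext_integral \<mu> (\<lambda>x. ereal (entropy_density (exp 1) \<nu> \<mu> x))
      else \<infinity>)"

definition mutual_info ::
  "'a::topological_space measure \<Rightarrow> ('a \<Rightarrow> 'b::topological_space measure) \<Rightarrow> ereal" where
  "mutual_info \<mu> K = relative_entropy (joint_law \<mu> K) (\<mu> \<Otimes>\<^sub>M (\<mu> \<bind> K))"

definition info_kernels ::
  "'a::topological_space measure \<Rightarrow> real \<Rightarrow> ('a \<Rightarrow> 'b::topological_space measure) set" where
  "info_kernels \<pi> R = {\<Phi> \<in> markov_kernels. mutual_info \<pi> \<Phi> \<le> ereal R}"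

definition distortion_rate ::
  "'a::topological_space measure \<Rightarrow> real \<Rightarrow> ('a \<times> 'b::topological_space \<Rightarrow> ereal) \<Rightarrow> ereal" where
  "distortion_rate \<pi> R f =
     (INF \<Phi> \<in> {\<Phi> \<in> info_kernels \<pi> R. integral_defined (joint_law \<pi> \<Phi>) f}.
        ext_integral (joint_law \<pi> \<Phi>) f)"

section \<open>Controlled Markov processes\<close>

definition closed_loop ::
  "('x \<times> 'u \<Rightarrow> 'x measure) \<Rightarrow> ('x \<Rightarrow> 'u measure) \<Rightarrow> 'x \<Rightarrow> 'x measure" where
  "closed_loop Q \<Phi> x = \<Phi> x \<bind> (\<lambda>u. Q (x, u))"

definition discounted_kernels ::
  "('x::topological_space \<times> 'u::topological_space \<Rightarrow> 'x measure) \<Rightarrow> real \<Rightarrow>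
   'x measure \<Rightarrow> 'x measure \<Rightarrow> ('x \<Rightarrow> 'u measure) set" where
  "discounted_kernels Q \<beta> \<mu> \<pi> = {\<Phi> \<in> markov_kernels. \<forall>A \<in> sets borel.
     measure \<pi> A = (1 - \<beta>) * measure \<mu> A + \<beta> * measure (\<pi> \<bind> closed_loop Q \<Phi>) A}"

text \<open>
  Conditional law of \<open>(X\<^sub>t, U\<^sub>t)\<close> given the past \<open>\<omega> = ((X\<^sub>s, U\<^sub>s))\<close>, \<open>s < t\<close>.
\<close>
fun control_step ::
  "('x::topological_space \<times> 'u::topological_space \<Rightarrow> 'x measure) \<Rightarrow> 'x measure \<Rightarrow>
   (nat \<Rightarrow> 'x \<Rightarrow> 'u measure) \<Rightarrow> nat \<Rightarrow> (nat \<Rightarrow> 'x \<times> 'u) \<Rightarrow> ('x \<times> 'u) measure" where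
  "control_step Q \<mu> \<Phi> 0 \<omega> = joint_law \<mu> (\<Phi> 0)"
| "control_step Q \<mu> \<Phi> (Suc t) \<omega> = joint_law (Q (\<omega> t)) (\<Phi> (Suc t))"

text \<open>
  The path measure on \<open>(X \<times> U)\<^sup>\<nat>\<close>, given by the Ionescu-Tulcea theorem; \<open>\<omega> t\<close> is the pair \<open>(X\<^sub>t, U\<^sub>t)\<close>.
\<close>
definition process_law ::
  "('x::topological_space \<times> 'u::topological_space \<Rightarrow> 'x measure) \<Rightarrow> 'x measure \<Rightarrow>
   (nat \<Rightarrow> 'x \<Rightarrow> 'u measure) \<Rightarrow> (nat \<Rightarrow> 'x \<times> 'u) measure" where
  "process_law Q \<mu> \<Phi> =
     projective_family.lim UNIV
       (Ionescu_Tulcea.CI (control_step Q \<mu> \<Phi>) (\<lambda>_. borel \<Otimes>\<^sub>M borel)) (\<lambda>_. borel \<Otimes>\<^sub>M borel)"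

lemma measurable_joint_law:
  fixes \<Phi> :: "'x::second_countable_topology \<Rightarrow> 'u::second_countable_topology measure"
  assumes [measurable]: "\<Phi> \<in> markov_kernels"
  shows "(\<lambda>\<mu>. joint_law \<mu> \<Phi>) \<in> prob_algebra borel \<rightarrow>\<^sub>M prob_algebra (borel \<Otimes>\<^sub>M borel)"
  unfolding joint_law_def by measurable

lemma Ionescu_Tulcea_control_step:
  fixes Q :: "'x::second_countable_topology \<times> 'u::second_countable_topology \<Rightarrow> 'x measure"
  assumes Q: "Q \<in> markov_kernels" and \<mu>: "\<mu> \<in> prob_measures"
    and \<Phi>: "\<And>t. \<Phi> t \<in> markov_kernels"
  shows "Ionescu_Tulcea (control_step Q \<mu> \<Phi>) (\<lambda>_. borel \<Otimes>\<^sub>M borel)"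
proof -
  have Q'[measurable]: "Q \<in> borel \<Otimes>\<^sub>M borel \<rightarrow>\<^sub>M prob_algebra borel"
    using Q by (simp add: borel_prod)
  have *: "control_step Q \<mu> \<Phi> i \<in>
    Pi\<^sub>M {0..<i} (\<lambda>_. borel \<Otimes>\<^sub>M borel) \<rightarrow>\<^sub>M prob_algebra (borel \<Otimes>\<^sub>M borel)" for i
  proof (cases i)
    case 0
    have "control_step Q \<mu> \<Phi> 0 = (\<lambda>_. joint_law \<mu> (\<Phi> 0))"
      by (simp add: fun_eq_iff)
    then show ?thesis
      using measurable_space[OF measurable_joint_law[OF \<Phi>] \<mu>] by (simp add: 0)
  next
    case (Suc t)
    have "(\<lambda>\<omega>. Q (\<omega> t)) \<in> Pi\<^sub>M {0..<i} (\<lambda>_. borel \<Otimes>\<^sub>M borel) \<rightarrow>\<^sub>M prob_algebra borel"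
      unfolding Suc by measurable
    moreover have "control_step Q \<mu> \<Phi> i = (\<lambda>\<omega>. joint_law (Q (\<omega> t)) (\<Phi> i))"
      by (simp add: fun_eq_iff Suc)
    ultimately show ?thesis
      using measurable_compose[OF _ measurable_joint_law[OF \<Phi>]] by simp
  qed
  show ?thesis
  proof (rule Ionescu_Tulcea.intro)
    show "control_step Q \<mu> \<Phi> i \<in>
      Pi\<^sub>M {0..<i} (\<lambda>_. borel \<Otimes>\<^sub>M borel) \<rightarrow>\<^sub>M subprob_algebra (borel \<Otimes>\<^sub>M borel)" for i
      by (rule measurable_prob_algebraD[OF *])
    show "prob_space (control_step Q \<mu> \<Phi> i x)"
      if "x \<in> space (Pi\<^sub>M {0..<i} (\<lambda>_. borel \<Otimes>\<^sub>M borel))" for i x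
      using measurable_space[OF * that] by (simp add: space_prob_algebra)
  qed
qed

definition state_law ::
  "('x::topological_space \<times> 'u::topological_space \<Rightarrow> 'x measure) \<Rightarrow> 'x measure \<Rightarrow>
   (nat \<Rightarrow> 'x \<Rightarrow> 'u measure) \<Rightarrow> nat \<Rightarrow> 'x measure" where
  "state_law Q \<mu> \<Phi> t = distr (process_law Q \<mu> \<Phi>) borel (\<lambda>\<omega>. fst (\<omega> t))"

text \<open>Meant for nonnegative \<open>c\<close>.\<close>
definition discounted_cost ::
  "('x::topological_space \<times> 'u::topological_space \<Rightarrow> 'x measure) \<Rightarrow> ('x \<times> 'u \<Rightarrow> real) \<Rightarrow> real \<Rightarrow>
   'x measure \<Rightarrow> (nat \<Rightarrow> 'x \<Rightarrow> 'u measure) \<Rightarrow> ereal" where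
  "discounted_cost Q c \<beta> \<mu> \<Phi> =
     enn2ereal (\<integral>\<^sup>+ \<omega>. (\<Sum>t. ennreal (\<beta> ^ t * c (\<omega> t))) \<partial>process_law Q \<mu> \<Phi>)"

definition quasistationary ::
  "(nat \<Rightarrow> 'x::topological_space \<Rightarrow> 'u::topological_space measure) \<Rightarrow> bool" where
  "quasistationary \<Phi> \<longleftrightarrow>
     (\<exists>\<Phi>\<^sub>0 \<in> markov_kernels. \<exists>\<Phi>\<^sub>1 \<in> markov_kernels. \<exists>t\<^sub>0.
        \<forall>t. \<Phi> t = (if t < t\<^sub>0 then \<Phi>\<^sub>0 else \<Phi>\<^sub>1))"

definition info_control_laws ::
  "('x::topological_space \<times> 'u::topological_space \<Rightarrow> 'x measure) \<Rightarrow> 'x measure \<Rightarrow> real \<Rightarrow>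
   (nat \<Rightarrow> 'x \<Rightarrow> 'u measure) set" where
  "info_control_laws Q \<mu> R =
     {\<Phi>. quasistationary \<Phi> \<and> (\<forall>t. mutual_info (state_law Q \<mu> \<Phi> t) (\<Phi> t) \<le> ereal R)}"

end

theory Submission
  imports Defs
begin

text \<open>
  Follow \<open>\<Phi>\<^sup>*\<close> up to a time \<open>t\<^sub>0\<close> and a constant kernel, which carries no information, from then on.
  Iterating \<open>\<pi> = (1 - \<beta>) \<mu> + \<beta> \<pi> Q\<^bsub>\<Phi>*\<^esub>\<close> gives \<open>(1 - \<beta>) \<Sum>\<^bsub>t<n\<^esub> \<beta>\<^sup>t \<mu>\<^sub>t \<le> \<pi>\<close> for the state laws \<open>\<mu>\<^sub>t\<close> under \<open>\<Phi>\<^sup>*\<close>.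
  Hence the cost before \<open>t\<^sub>0\<close> is at most \<open>\<langle>\<pi> \<otimes> \<Phi>\<^sup>*, c\<rangle> / (1 - \<beta>)\<close>, and, as \<open>\<alpha> \<nu> \<le> \<pi>\<close> implies
  \<open>\<alpha> I(\<nu>, K) \<le> I(\<pi>, K)\<close>, also \<open>(1 - \<beta>) \<beta>\<^sup>t I(\<mu>\<^sub>t, \<Phi>\<^sup>*) \<le> I(\<pi>, \<Phi>\<^sup>*)\<close>. With \<open>t\<^sub>0\<close> the first time at which
  \<open>\<beta>\<^sup>t C \<le> (1 - \<beta>) \<epsilon>\<close>, the tail costs at most \<open>\<epsilon>\<close> and the rate constraint holds before \<open>t\<^sub>0\<close>. Finally,
  \<open>\<langle>\<pi> \<otimes> \<Phi>\<^sup>*, \<beta> Q h\<rangle> = \<langle>\<pi>, h\<rangle> - (1 - \<beta>) \<langle>\<mu>, h\<rangle>\<close>, so the terms in \<open>h\<close> cancel on the right-hand side.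
\<close>

section \<open>Joint laws and state laws\<close>

lemma kernel_measurable_joint [measurable]:
  fixes K :: "'a::second_countable_topology \<Rightarrow> 'b::second_countable_topology measure"
  assumes [measurable]: "K \<in> markov_kernels"
  shows "(\<lambda>x. distr (K x) (borel \<Otimes>\<^sub>M borel) (Pair x)) \<in> borel \<rightarrow>\<^sub>M prob_algebra (borel \<Otimes>\<^sub>M borel)"
  by measurable

lemma prob_measuresD:
  assumes "\<mu> \<in> prob_measures"
  shows "prob_space \<mu>" "sets \<mu> = sets borel" "space \<mu> = UNIV"
  using assms sets_eq_imp_space_eq[of \<mu> borel] by (auto simp: space_prob_algebra)

lemma kernel_prob_measures: "K \<in> markov_kernels \<Longrightarrow> K x \<in> prob_measures"
  using measurable_space[of K borel "prob_algebra borel" x] by simp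

lemma joint_law_prob:
  fixes K :: "'a::second_countable_topology \<Rightarrow> 'b::second_countable_topology measure"
  assumes "\<mu> \<in> prob_measures" "K \<in> markov_kernels"
  shows "prob_space (joint_law \<mu> K)" "sets (joint_law \<mu> K) = sets (borel \<Otimes>\<^sub>M borel)"
  using measurable_space[OF measurable_joint_law[OF assms(2)] assms(1)]
  by (auto simp: space_prob_algebra)

lemma bind_prob_measures:
  assumes "\<mu> \<in> prob_measures" "K \<in> markov_kernels"
  shows "\<mu> \<bind> K \<in> prob_measures"
proof -
  have "(\<lambda>\<mu>. \<mu> \<bind> K) \<in> prob_algebra borel \<rightarrow>\<^sub>M prob_algebra borel"
    using assms(2) by measurable
  from measurable_space[OF this assms(1)] show ?thesis .
qed

lemma nn_integral_bind_kernel: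
  assumes \<mu>: "\<mu> \<in> prob_measures" and K: "K \<in> borel \<rightarrow>\<^sub>M prob_algebra N"
    and f: "f \<in> borel_measurable N"
  shows "(\<integral>\<^sup>+y. f y \<partial>(\<mu> \<bind> K)) = (\<integral>\<^sup>+x. (\<integral>\<^sup>+y. f y \<partial>K x) \<partial>\<mu>)"
proof (rule nn_integral_bind[OF f])
  show "K \<in> \<mu> \<rightarrow>\<^sub>M subprob_algebra N"
    using measurable_prob_algebraD[OF K] prob_measuresD(2)[OF \<mu>] measurable_cong_sets by blast
qed

lemma nn_integral_joint_law:
  fixes K :: "'a::second_countable_topology \<Rightarrow> 'b::second_countable_topology measure"
  assumes \<mu>: "\<mu> \<in> prob_measures" and K: "K \<in> markov_kernels"
    and f [measurable]: "f \<in> borel_measurable (borel \<Otimes>\<^sub>M borel)"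
  shows "(\<integral>\<^sup>+p. f p \<partial>joint_law \<mu> K) = (\<integral>\<^sup>+x. (\<integral>\<^sup>+u. f (x, u) \<partial>K x) \<partial>\<mu>)"
proof -
  have "(\<integral>\<^sup>+p. f p \<partial>joint_law \<mu> K) =
      (\<integral>\<^sup>+x. (\<integral>\<^sup>+p. f p \<partial>distr (K x) (borel \<Otimes>\<^sub>M borel) (Pair x)) \<partial>\<mu>)"
    unfolding joint_law_def
    by (rule nn_integral_bind_kernel[OF \<mu> kernel_measurable_joint[OF K] f])
  also have "\<dots> = (\<integral>\<^sup>+x. (\<integral>\<^sup>+u. f (x, u) \<partial>K x) \<partial>\<mu>)"
  proof (rule nn_integral_cong)
    fix x
    have [measurable_cong]: "sets (K x) = sets borel"
      using kernel_prob_measures[OF K] by (rule prob_measuresD)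
    show "(\<integral>\<^sup>+p. f p \<partial>distr (K x) (borel \<Otimes>\<^sub>M borel) (Pair x)) = (\<integral>\<^sup>+u. f (x, u) \<partial>K x)"
      by (rule nn_integral_distr) measurable
  qed
  finally show ?thesis .
qed

lemma nn_integral_joint_law_fst:
  fixes K :: "'a::second_countable_topology \<Rightarrow> 'b::second_countable_topology measure"
  assumes \<mu>: "\<mu> \<in> prob_measures" and K: "K \<in> markov_kernels"
    and [measurable]: "f \<in> borel_measurable borel"
  shows "(\<integral>\<^sup>+p. f (fst p) \<partial>joint_law \<mu> K) = (\<integral>\<^sup>+x. f x \<partial>\<mu>)"
proof -
  have "(\<integral>\<^sup>+p. f (fst p) \<partial>joint_law \<mu> K) = (\<integral>\<^sup>+x. (\<integral>\<^sup>+u. f x \<partial>K x) \<partial>\<mu>)"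
    by (subst nn_integral_joint_law[OF \<mu> K]) auto
  also have "\<dots> = (\<integral>\<^sup>+x. f x \<partial>\<mu>)"
    using prob_measuresD(1)[OF kernel_prob_measures[OF K], THEN prob_space.emeasure_space_1]
    by simp
  finally show ?thesis .
qed

lemma distr_joint_law_fst:
  fixes K :: "'a::second_countable_topology \<Rightarrow> 'b::second_countable_topology measure"
  assumes \<mu>: "\<mu> \<in> prob_measures" and K: "K \<in> markov_kernels"
  shows "distr (joint_law \<mu> K) borel fst = \<mu>"
proof (rule measure_eqI)
  fix A assume "A \<in> sets (distr (joint_law \<mu> K) borel fst)"
  then have [measurable]: "A \<in> sets borel" by simp
  note [measurable_cong] = joint_law_prob(2)[OF \<mu> K] prob_measuresD(2)[OF \<mu>]
  have "emeasure (distr (joint_law \<mu> K) borel fst) A =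
      (\<integral>\<^sup>+y. indicator A y \<partial>distr (joint_law \<mu> K) borel fst)"
    by (subst nn_integral_indicator) auto
  also have "\<dots> = (\<integral>\<^sup>+p. indicator A (fst p) \<partial>joint_law \<mu> K)"
    by (rule nn_integral_distr) measurable
  also have "\<dots> = (\<integral>\<^sup>+x. indicator A x \<partial>\<mu>)"
    by (rule nn_integral_joint_law_fst[OF \<mu> K]) measurable
  also have "\<dots> = emeasure \<mu> A"
    by (subst nn_integral_indicator) auto
  finally show "emeasure (distr (joint_law \<mu> K) borel fst) A = emeasure \<mu> A" .
qed (simp add: prob_measuresD(2)[OF \<mu>])

lemma distr_joint_law_snd:
  fixes K :: "'a::second_countable_topology \<Rightarrow> 'b::second_countable_topology measure"
  assumes \<mu>: "\<mu> \<in> prob_measures" and K: "K \<in> markov_kernels"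
  shows "distr (joint_law \<mu> K) borel snd = \<mu> \<bind> K"
proof (rule measure_eqI)
  fix A assume "A \<in> sets (distr (joint_law \<mu> K) borel snd)"
  then have [measurable]: "A \<in> sets borel" by simp
  note [measurable_cong] = joint_law_prob(2)[OF \<mu> K] prob_measuresD(2)[OF \<mu>]
    prob_measuresD(2)[OF bind_prob_measures[OF \<mu> K]]
  have "emeasure (distr (joint_law \<mu> K) borel snd) A =
      (\<integral>\<^sup>+y. indicator A y \<partial>distr (joint_law \<mu> K) borel snd)"
    by (subst nn_integral_indicator) auto
  also have "\<dots> = (\<integral>\<^sup>+p. indicator A (snd p) \<partial>joint_law \<mu> K)"
    by (rule nn_integral_distr) measurable
  also have "\<dots> = (\<integral>\<^sup>+x. (\<integral>\<^sup>+u. indicator A u \<partial>K x) \<partial>\<mu>)"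
    by (subst nn_integral_joint_law[OF \<mu> K]) auto
  also have "\<dots> = (\<integral>\<^sup>+y. indicator A y \<partial>(\<mu> \<bind> K))"
    by (rule nn_integral_bind_kernel[OF \<mu> K, symmetric]) measurable
  also have "\<dots> = emeasure (\<mu> \<bind> K) A"
    by (subst nn_integral_indicator) auto
  finally show "emeasure (distr (joint_law \<mu> K) borel snd) A = emeasure (\<mu> \<bind> K) A" .
qed (simp add: prob_measuresD(2)[OF bind_prob_measures[OF \<mu> K]])

section \<open>The closed-loop chain and the coordinates of the path measure\<close>

lemma closed_loop_kernel:
  fixes Q :: "'x::second_countable_topology \<times> 'u::second_countable_topology \<Rightarrow> 'x measure"
  assumes Q: "Q \<in> markov_kernels" and K [measurable]: "K \<in> markov_kernels"
  shows "closed_loop Q K \<in> markov_kernels"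
proof -
  have [measurable]: "Q \<in> borel \<Otimes>\<^sub>M borel \<rightarrow>\<^sub>M prob_algebra borel"
    using Q by (simp add: borel_prod)
  show ?thesis unfolding closed_loop_def[abs_def] by measurable
qed

lemma nn_integral_bind_closed_loop:
  fixes Q :: "'x::second_countable_topology \<times> 'u::second_countable_topology \<Rightarrow> 'x measure"
  assumes Q: "Q \<in> markov_kernels" and K: "K \<in> markov_kernels" and \<mu>: "\<mu> \<in> prob_measures"
    and f [measurable]: "f \<in> borel_measurable borel"
  shows "(\<integral>\<^sup>+y. f y \<partial>(\<mu> \<bind> closed_loop Q K)) = (\<integral>\<^sup>+p. (\<integral>\<^sup>+y. f y \<partial>Q p) \<partial>joint_law \<mu> K)"
proof -
  have Q' [measurable]: "Q \<in> borel \<Otimes>\<^sub>M borel \<rightarrow>\<^sub>M prob_algebra borel"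
    using Q by (simp add: borel_prod)
  have Qs [measurable]: "Q \<in> borel \<Otimes>\<^sub>M borel \<rightarrow>\<^sub>M subprob_algebra borel"
    using Q' by (rule measurable_prob_algebraD)
  have "(\<integral>\<^sup>+y. f y \<partial>(\<mu> \<bind> closed_loop Q K)) = (\<integral>\<^sup>+x. (\<integral>\<^sup>+y. f y \<partial>closed_loop Q K x) \<partial>\<mu>)"
    by (rule nn_integral_bind_kernel[OF \<mu> closed_loop_kernel[OF Q K] f])
  also have "\<dots> = (\<integral>\<^sup>+x. (\<integral>\<^sup>+u. (\<integral>\<^sup>+y. f y \<partial>Q (x, u)) \<partial>K x) \<partial>\<mu>)"
    unfolding closed_loop_def
    by (intro nn_integral_cong nn_integral_bind_kernel[OF kernel_prob_measures[OF K] _ f]) measurable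
  also have "\<dots> = (\<integral>\<^sup>+p. (\<integral>\<^sup>+y. f y \<partial>Q p) \<partial>joint_law \<mu> K)"
    by (rule nn_integral_joint_law[OF \<mu> K, symmetric]) measurable
  finally show ?thesis .
qed

text \<open>A one-step recursion that stands in for \<open>state_law\<close>, so that later
  estimates are inductions over time and need no path measure.\<close>

primrec marginal_law ::
  "('x::topological_space \<times> 'u::topological_space \<Rightarrow> 'x measure) \<Rightarrow> 'x measure \<Rightarrow>
   (nat \<Rightarrow> 'x \<Rightarrow> 'u measure) \<Rightarrow> nat \<Rightarrow> 'x measure" where
  "marginal_law Q \<mu> \<Phi> 0 = \<mu>"
| "marginal_law Q \<mu> \<Phi> (Suc t) = marginal_law Q \<mu> \<Phi> t \<bind> closed_loop Q (\<Phi> t)"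

text \<open>The kernel at time \<open>t\<close> acts only after \<open>X\<^sub>t\<close> is drawn.
  Hence a switch at \<open>t\<^sub>0\<close> leaves the state law unchanged up to and including
  \<open>t\<^sub>0\<close>.\<close>

lemma marginal_law_cong:
  assumes "\<And>s. s < t \<Longrightarrow> \<Phi> s = \<Psi> s"
  shows "marginal_law Q \<mu> \<Phi> t = marginal_law Q \<mu> \<Psi> t"
  using assms by (induction t) auto

lemma marginal_law_prob:
  fixes Q :: "'x::second_countable_topology \<times> 'u::second_countable_topology \<Rightarrow> 'x measure"
  assumes "Q \<in> markov_kernels" "\<mu> \<in> prob_measures" "\<And>t. \<Phi> t \<in> markov_kernels"
  shows "marginal_law Q \<mu> \<Phi> t \<in> prob_measures"
  by (induction t)
    (simp_all only: marginal_law.simps assms bind_prob_measures closed_loop_kernel)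

text \<open>The first \<open>t + 1\<close> coordinates of a path follow an iterated kernel whose
  last coordinate is drawn from \<open>control_step\<close>. That kernel sees the past only through
  the preceding pair, so integrating out the earlier coordinates leaves the recursion of
  \<open>marginal_law\<close>.\<close>

lemma nn_integral_process_law:
  fixes Q :: "'x::second_countable_topology \<times> 'u::second_countable_topology \<Rightarrow> 'x measure"
  assumes Q: "Q \<in> markov_kernels" and \<mu>: "\<mu> \<in> prob_measures"
    and \<Phi>: "\<And>t. \<Phi> t \<in> markov_kernels"
    and f: "f \<in> borel_measurable (borel \<Otimes>\<^sub>M borel)"
  shows "(\<integral>\<^sup>+\<omega>. f (\<omega> t) \<partial>process_law Q \<mu> \<Phi>) =
         (\<integral>\<^sup>+p. f p \<partial>joint_law (marginal_law Q \<mu> \<Phi> t) (\<Phi> t))"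
proof -
  interpret IT: Ionescu_Tulcea "control_step Q \<mu> \<Phi>"
      "\<lambda>_. borel \<Otimes>\<^sub>M borel :: ('x \<times> 'u) measure"
    using Q \<mu> \<Phi> by (rule Ionescu_Tulcea_control_step)
  \<comment> \<open>The extension kernel \<open>IT.eP t\<close> keeps the past and appends one point
    drawn from \<open>control_step\<close>; a function of coordinate \<open>t\<close> sees only that
    point.\<close>
  have step: "(\<integral>\<^sup>+\<omega>. g (\<omega> t) \<partial>IT.C 0 (Suc t) (\<lambda>x. undefined)) =
      (\<integral>\<^sup>+\<omega>. (\<integral>\<^sup>+p. g p \<partial>control_step Q \<mu> \<Phi> t \<omega>) \<partial>IT.C 0 t (\<lambda>x. undefined))"
    if g [measurable]: "g \<in> borel_measurable (borel \<Otimes>\<^sub>M borel)" for t g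
  proof -
    have eq: "IT.C 0 t (\<lambda>x. undefined) \<rightarrow>\<^sub>M N =
        PiM {0..<t} (\<lambda>_. borel \<Otimes>\<^sub>M borel) \<rightarrow>\<^sub>M N" for N :: "(nat \<Rightarrow> 'x \<times> 'u) measure measure"
      using IT.sets_C[of "\<lambda>x. undefined" 0 t] by (intro measurable_cong_sets) auto
    have "(\<integral>\<^sup>+\<omega>. g (\<omega> t) \<partial>IT.C 0 (Suc t) (\<lambda>x. undefined)) =
      (\<integral>\<^sup>+\<omega>. (\<integral>\<^sup>+\<omega>'. g (\<omega>' t) \<partial>IT.eP t \<omega>) \<partial>IT.C 0 t (\<lambda>x. undefined))"
      unfolding IT.C.simps add_0
    proof (rule nn_integral_bind[where B="PiM {0..<Suc t} (\<lambda>_. borel \<Otimes>\<^sub>M borel)"])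
      show "(\<lambda>\<omega>'. g (\<omega>' t)) \<in> borel_measurable (PiM {0..<Suc t} (\<lambda>_. borel \<Otimes>\<^sub>M borel))"
        by measurable
      show "IT.eP t \<in> IT.C 0 t (\<lambda>x. undefined) \<rightarrow>\<^sub>M
          subprob_algebra (PiM {0..<Suc t} (\<lambda>_. borel \<Otimes>\<^sub>M borel))"
        using IT.measurable_eP[of t] by (simp only: eq)
    qed
    also have "\<dots> = (\<integral>\<^sup>+\<omega>. (\<integral>\<^sup>+p. g p \<partial>control_step Q \<mu> \<Phi> t \<omega>) \<partial>IT.C 0 t (\<lambda>x. undefined))"
    proof (rule nn_integral_cong)
      fix \<omega> assume "\<omega> \<in> space (IT.C 0 t (\<lambda>x. undefined))"
      then have "\<omega> \<in> space (PiM {0..<t} (\<lambda>_. borel \<Otimes>\<^sub>M borel :: ('x \<times> 'u) measure))"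
        using IT.space_C[of "\<lambda>x. undefined" 0 t] by simp
      then show "(\<integral>\<^sup>+\<omega>'. g (\<omega>' t) \<partial>IT.eP t \<omega>) = (\<integral>\<^sup>+p. g p \<partial>control_step Q \<mu> \<Phi> t \<omega>)"
        by (subst IT.nn_integral_eP) auto
    qed
    finally show ?thesis .
  qed
  \<comment> \<open>The test function is generalized, since the induction step applies the
    hypothesis to the \<open>Q\<close>-average of \<open>?G\<close> instead of
    \<open>g\<close>.\<close>
  have C: "(\<integral>\<^sup>+\<omega>. g (\<omega> t) \<partial>IT.C 0 (Suc t) (\<lambda>x. undefined)) =
      (\<integral>\<^sup>+p. g p \<partial>joint_law (marginal_law Q \<mu> \<Phi> t) (\<Phi> t))"
    if "g \<in> borel_measurable (borel \<Otimes>\<^sub>M borel)" for t g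
    using that
  proof (induction t arbitrary: g)
    case 0
    \<comment> \<open>At time 0 the step kernel ignores the past, so only the total mass 1 of
      \<open>IT.C 0 0\<close> matters.\<close>
    show ?case
      using prob_space.emeasure_space_1[OF IT.prob_space_C[of "\<lambda>x. undefined" 0 0]]
      by (subst step[OF 0]) simp
  next
    case (Suc t)
    note [measurable] = Suc.prems
    let ?m = "marginal_law Q \<mu> \<Phi>"
    let ?G = "\<lambda>x. \<integral>\<^sup>+u. g (x, u) \<partial>\<Phi> (Suc t) x"
    have Q' [measurable]: "Q \<in> borel \<Otimes>\<^sub>M borel \<rightarrow>\<^sub>M prob_algebra borel"
      using Q by (simp add: borel_prod)
    have [measurable]: "Q \<in> borel \<Otimes>\<^sub>M borel \<rightarrow>\<^sub>M subprob_algebra borel"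
      using Q' by (rule measurable_prob_algebraD)
    have [measurable]: "\<Phi> (Suc t) \<in> borel \<rightarrow>\<^sub>M subprob_algebra borel"
      using \<Phi> by (rule measurable_prob_algebraD)
    have [measurable]: "?G \<in> borel_measurable borel"
      by (rule nn_integral_measurable_subprob_algebra2[where N=borel]) (simp_all add: Suc.prems)
    have m: "?m s \<in> prob_measures" for s
      using Q \<mu> \<Phi> by (rule marginal_law_prob)
    have G: "(\<integral>\<^sup>+p. g p \<partial>joint_law \<nu> (\<Phi> (Suc t))) = (\<integral>\<^sup>+x. ?G x \<partial>\<nu>)"
      if "\<nu> \<in> prob_measures" for \<nu>
      using that \<Phi> Suc.prems by (rule nn_integral_joint_law)
    have "(\<integral>\<^sup>+\<omega>. g (\<omega> (Suc t)) \<partial>IT.C 0 (Suc (Suc t)) (\<lambda>x. undefined)) =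
        (\<integral>\<^sup>+\<omega>. (\<integral>\<^sup>+p. g p \<partial>control_step Q \<mu> \<Phi> (Suc t) \<omega>) \<partial>IT.C 0 (Suc t) (\<lambda>x. undefined))"
      by (rule step[OF Suc.prems])
    also have "\<dots> = (\<integral>\<^sup>+\<omega>. (\<integral>\<^sup>+x. ?G x \<partial>Q (\<omega> t)) \<partial>IT.C 0 (Suc t) (\<lambda>x. undefined))"
      unfolding control_step.simps by (intro nn_integral_cong G kernel_prob_measures Q)
    also have "\<dots> = (\<integral>\<^sup>+p. (\<integral>\<^sup>+x. ?G x \<partial>Q p) \<partial>joint_law (?m t) (\<Phi> t))"
      by (rule Suc.IH) measurable
    also have "\<dots> = (\<integral>\<^sup>+x. ?G x \<partial>?m (Suc t))"
      unfolding marginal_law.simps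
      by (rule nn_integral_bind_closed_loop[OF Q \<Phi> m, symmetric]) measurable
    also have "\<dots> = (\<integral>\<^sup>+p. g p \<partial>joint_law (?m (Suc t)) (\<Phi> (Suc t)))"
      by (rule G[OF m, symmetric])
    finally show ?case .
  qed
  let ?J = "{0..<Suc t}"
  \<comment> \<open>\<open>IT.CI ?J\<close> is a restriction of the iterate of length
    \<open>IT.up_to ?J\<close>. As \<open>?J\<close> is an initial segment, this iterate has exactly
    the coordinates 0 to \<open>t\<close>.\<close>
  have J: "IT.up_to ?J = Suc t"
    using IT.up_to_iff[of ?J] by (intro antisym) (auto simp: not_less_eq_eq[symmetric])
  have [measurable_cong]: "sets (process_law Q \<mu> \<Phi>) = sets (PiM UNIV (\<lambda>_. borel \<Otimes>\<^sub>M borel))"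
    unfolding process_law_def by (rule IT.PF.sets_lim)
  note [measurable] = f
  have "(\<integral>\<^sup>+\<omega>. f (\<omega> t) \<partial>process_law Q \<mu> \<Phi>) =
      (\<integral>\<^sup>+\<omega>. f (\<omega> t) \<partial>distr (process_law Q \<mu> \<Phi>) (PiM ?J (\<lambda>_. borel \<Otimes>\<^sub>M borel)) (\<lambda>x. restrict x ?J))"
    by (subst nn_integral_distr) (auto intro!: measurable_restrict)
  also have "\<dots> = (\<integral>\<^sup>+\<omega>. f (\<omega> t) \<partial>IT.CI ?J)"
    unfolding process_law_def by (subst IT.distr_lim) auto
  also have "\<dots> = (\<integral>\<^sup>+\<omega>. f (\<omega> t) \<partial>IT.C 0 (Suc t) (\<lambda>x. undefined))"
  proof -
    have "sets (IT.C 0 (Suc t) (\<lambda>x. undefined)) = sets (PiM ?J (\<lambda>_. borel \<Otimes>\<^sub>M borel))"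
      using IT.sets_C[of "\<lambda>x. undefined" 0 "Suc t"] by simp
    then have eq: "IT.C 0 (Suc t) (\<lambda>x. undefined) \<rightarrow>\<^sub>M N = PiM ?J (\<lambda>_. borel \<Otimes>\<^sub>M borel) \<rightarrow>\<^sub>M N"
      for N :: "(nat \<Rightarrow> 'x \<times> 'u) measure"
      by (intro measurable_cong_sets) auto
    have [measurable]: "(\<lambda>f. restrict f ?J) \<in>
        IT.C 0 (Suc t) (\<lambda>x. undefined) \<rightarrow>\<^sub>M PiM ?J (\<lambda>_. borel \<Otimes>\<^sub>M borel)"
      unfolding eq by (auto intro!: measurable_restrict)
    show ?thesis
      unfolding IT.CI_def J by (subst nn_integral_distr) (auto simp del: IT.C.simps)
  qed
  finally show ?thesis by (simp only: C[OF f])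
qed

lemma state_law_eq_marginal_law:
  fixes Q :: "'x::second_countable_topology \<times> 'u::second_countable_topology \<Rightarrow> 'x measure"
  assumes Q: "Q \<in> markov_kernels" and \<mu>: "\<mu> \<in> prob_measures"
    and \<Phi>: "\<And>t. \<Phi> t \<in> markov_kernels"
  shows "state_law Q \<mu> \<Phi> t = marginal_law Q \<mu> \<Phi> t"
proof -
  interpret IT: Ionescu_Tulcea "control_step Q \<mu> \<Phi>"
      "\<lambda>_. borel \<Otimes>\<^sub>M borel :: ('x \<times> 'u) measure"
    using Q \<mu> \<Phi> by (rule Ionescu_Tulcea_control_step)
  have [measurable_cong]: "sets (process_law Q \<mu> \<Phi>) = sets (PiM UNIV (\<lambda>_. borel \<Otimes>\<^sub>M borel))"
    unfolding process_law_def by (rule IT.PF.sets_lim)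
  have m: "marginal_law Q \<mu> \<Phi> t \<in> prob_measures"
    using Q \<mu> \<Phi> by (rule marginal_law_prob)
  show ?thesis
  proof (rule measure_eqI)
    fix A assume "A \<in> sets (state_law Q \<mu> \<Phi> t)"
    then have A [measurable]: "A \<in> sets borel" by (simp add: state_law_def)
    have "emeasure (state_law Q \<mu> \<Phi> t) A = (\<integral>\<^sup>+x. indicator A x \<partial>state_law Q \<mu> \<Phi> t)"
      by (subst nn_integral_indicator) (auto simp: state_law_def)
    also have "\<dots> = (\<integral>\<^sup>+\<omega>. indicator A (fst (\<omega> t)) \<partial>process_law Q \<mu> \<Phi>)"
      unfolding state_law_def by (rule nn_integral_distr) measurable
    also have "\<dots> = (\<integral>\<^sup>+p. indicator A (fst p) \<partial>joint_law (marginal_law Q \<mu> \<Phi> t) (\<Phi> t))"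
      by (rule nn_integral_process_law[OF Q \<mu> \<Phi>]) measurable
    also have "\<dots> = (\<integral>\<^sup>+x. indicator A x \<partial>marginal_law Q \<mu> \<Phi> t)"
      by (rule nn_integral_joint_law_fst[OF m \<Phi>]) measurable
    also have "\<dots> = emeasure (marginal_law Q \<mu> \<Phi> t) A"
      using prob_measuresD(2)[OF m] by (subst nn_integral_indicator) auto
    finally show "emeasure (state_law Q \<mu> \<Phi> t) A = emeasure (marginal_law Q \<mu> \<Phi> t) A" .
  qed (simp add: state_law_def prob_measuresD(2)[OF m])
qed

section \<open>Relative entropy and densities\<close>

lemma e2ennreal_ereal: "e2ennreal (ereal r) = ennreal r"
  by (simp add: ennreal.abs_eq)

text \<open>Agreement almost everywhere suffices, which admits integrands such as
  \<open>kernel_apply Q h\<close> that may be infinite on a null set.\<close>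

lemma ext_integral_eq_integral:
  assumes f [measurable]: "f \<in> borel_measurable M" and g: "integrable M g"
    and eq: "AE x in M. f x = ereal (g x)"
  shows "ext_integral M f = ereal (\<integral>x. g x \<partial>M)"
proof -
  have pos: "(\<integral>\<^sup>+ x. e2ennreal (f x) \<partial>M) = (\<integral>\<^sup>+ x. ennreal (g x) \<partial>M)"
    using eq by (intro nn_integral_cong_AE) (auto simp: e2ennreal_ereal)
  have neg: "(\<integral>\<^sup>+ x. e2ennreal (- f x) \<partial>M) = (\<integral>\<^sup>+ x. ennreal (- g x) \<partial>M)"
    using eq by (intro nn_integral_cong_AE) (auto simp: e2ennreal_ereal)
  obtain r q where rq: "0 \<le> r" "0 \<le> q" "(\<integral>\<^sup>+ x. ennreal (g x) \<partial>M) = ennreal r"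
      "(\<integral>\<^sup>+ x. ennreal (- g x) \<partial>M) = ennreal q" "(\<integral>x. g x \<partial>M) = r - q"
    using integrableE[OF g] by metis
  then show ?thesis
    using f by (simp add: ext_integral_def integral_defined_def pos neg)
qed

text \<open>With a finite negative part the extended integral is never the dummy value, so a real
  upper bound forces the positive part to be finite as well.\<close>

lemma ext_integral_le_integrable:
  assumes f [measurable]: "f \<in> borel_measurable M"
    and le: "ext_integral M (\<lambda>x. ereal (f x)) \<le> ereal r"
    and neg: "(\<integral>\<^sup>+ x. ennreal (- f x) \<partial>M) < \<infinity>"
  shows "integrable M f" "(\<integral>x. f x \<partial>M) \<le> r"
proof -
  have "(\<integral>\<^sup>+ x. ennreal (f x) \<partial>M) < \<infinity>"
    using le neg
    by (cases "(\<integral>\<^sup>+ x. ennreal (f x) \<partial>M)"; cases "(\<integral>\<^sup>+ x. ennreal (- f x) \<partial>M)")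
      (auto simp: ext_integral_def integral_defined_def e2ennreal_ereal)
  then show "integrable M f"
    using neg by (auto simp: real_integrable_def)
  then show "(\<integral>x. f x \<partial>M) \<le> r"
    using ext_integral_eq_integral[of "\<lambda>x. ereal (f x)" M f] le by simp
qed

lemma ext_integral_cong_AE:
  assumes "f \<in> borel_measurable M" "g \<in> borel_measurable M" "AE x in M. f x = g x"
  shows "ext_integral M f = ext_integral M g"
proof -
  have "(\<integral>\<^sup>+ x. e2ennreal (f x) \<partial>M) = (\<integral>\<^sup>+ x. e2ennreal (g x) \<partial>M)"
    "(\<integral>\<^sup>+ x. e2ennreal (- f x) \<partial>M) = (\<integral>\<^sup>+ x. e2ennreal (- g x) \<partial>M)"
    using assms(3) by (auto intro!: nn_integral_cong_AE)
  then show ?thesis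
    using assms by (simp add: ext_integral_def integral_defined_def)
qed

text \<open>Radon-Nikodym derivatives agree \<open>T\<close>-almost everywhere, hence also almost
  everywhere for \<open>P\<close>, which has a density relative to \<open>T\<close>. Any explicit
  density may therefore replace \<open>RN_deriv\<close>.\<close>

lemma relative_entropy_density:
  fixes q :: "'a \<Rightarrow> real"
  assumes T: "prob_space T" and q [measurable]: "q \<in> borel_measurable T" and nn: "\<And>x. 0 \<le> q x"
    and P: "P = density T q"
  shows "relative_entropy P T = ext_integral P (\<lambda>x. ereal (ln (q x)))"
proof -
  interpret T: prob_space T by fact
  have [measurable_cong]: "sets P = sets T" by (simp add: P)
  have "AE x in T. ennreal (q x) = RN_deriv T P x"
    by (rule T.RN_deriv_unique) (simp_all add: P)
  then have "AE x in T. entropy_density (exp 1) T P x = ln (q x)"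
    by eventually_elim (use nn in \<open>auto simp: entropy_density_def log_def dest: sym\<close>)
  then have "AE x in P. entropy_density (exp 1) T P x = ln (q x)"
    unfolding P by (subst AE_density) auto
  then have "ext_integral P (\<lambda>x. ereal (entropy_density (exp 1) T P x)) =
      ext_integral P (\<lambda>x. ereal (ln (q x)))"
    by (intro ext_integral_cong_AE) auto
  moreover have "absolutely_continuous T P"
    unfolding P by (rule absolutely_continuousI_density) simp
  ultimately show ?thesis by (simp add: relative_entropy_def)
qed

text \<open>Pointwise, \<open>- q ln q \<le> 1 - q \<le> 1\<close>. So a log-density always has an
  integrable negative part, and only its positive part needs a separate argument.\<close>

lemma nn_integral_neg_ln_density_le:
  fixes q :: "'a \<Rightarrow> real"
  assumes T: "prob_space T" and q [measurable]: "q \<in> borel_measurable T" and nn: "\<And>x. 0 \<le> q x"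
    and P: "P = density T q"
  shows "(\<integral>\<^sup>+ x. ennreal (- ln (q x)) \<partial>P) \<le> 1"
proof -
  interpret T: prob_space T by fact
  have "(\<integral>\<^sup>+ x. ennreal (- ln (q x)) \<partial>P) = (\<integral>\<^sup>+ x. ennreal (q x) * ennreal (- ln (q x)) \<partial>T)"
    unfolding P by (rule nn_integral_density) auto
  also have "\<dots> \<le> (\<integral>\<^sup>+ x. 1 \<partial>T)"
  proof (rule nn_integral_mono)
    fix x
    show "ennreal (q x) * ennreal (- ln (q x)) \<le> 1"
    proof (cases "q x = 0")
      case False
      then have q: "0 < q x" using nn[of x] by simp
      have "- ln (q x) \<le> 1 / q x - 1"
        using ln_le_minus_one[of "1 / q x"] q by (simp add: ln_div)
      then have "q x * - ln (q x) \<le> q x * (1 / q x - 1)"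
        using q by (intro mult_left_mono) auto
      also have "\<dots> \<le> 1" using q by (simp add: field_simps)
      finally show ?thesis
        using q by (simp add: ennreal_mult'[symmetric])
    qed simp
  qed
  also have "\<dots> = 1" by (simp add: T.emeasure_space_1)
  finally show ?thesis .
qed

text \<open>From \<open>ln f \<ge> 1 - 1 / f\<close>, the integral is at least that of
  \<open>w\<close> under \<open>P\<close> minus that of \<open>w\<close> under \<open>S\<close>,
  which is 0 by \<open>eq\<close>. For \<open>w = 1\<close> this is the nonnegativity of relative
  entropy; a nonconstant weight is what lets \<open>ln f\<close> be compared under two input
  laws.\<close>

lemma weighted_gibbs:
  fixes f w :: "'a \<Rightarrow> real"
  assumes S: "prob_space S" and P: "P = density S f" and pP: "prob_space P"
    and f [measurable]: "f \<in> borel_measurable S" and fnn: "\<And>x. 0 \<le> f x"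
    and w [measurable]: "w \<in> borel_measurable S" and wnn: "\<And>x. 0 \<le> w x" and wB: "\<And>x. w x \<le> B"
    and eq: "(\<integral>x. w x \<partial>P) = (\<integral>x. w x \<partial>S)"
    and int: "integrable P (\<lambda>x. ln (f x))"
  shows "0 \<le> (\<integral>x. w x * ln (f x) \<partial>P)"
proof -
  interpret S: prob_space S by fact
  interpret P: prob_space P by fact
  have [measurable_cong]: "sets P = sets S" by (simp add: P)
  have wP: "integrable P w"
    using wnn wB by (intro P.integrable_const_bound[of _ B]) auto
  have wS: "integrable S w"
    using wnn wB by (intro S.integrable_const_bound[of _ B]) auto
  \<comment> \<open>Where \<open>f x = 0\<close> the product is 0, as division by zero yields zero;
    elsewhere it equals \<open>w x\<close>. The integral of \<open>w / f\<close> under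
    \<open>P\<close> may thus fall short of that of \<open>w\<close> under \<open>S\<close>, but
    only in the useful direction.\<close>
  have le1: "norm (f x * (w x / f x)) \<le> norm (w x)" for x
    using wnn[of x] fnn[of x] by auto
  have "integrable S (\<lambda>x. f x * (w x / f x))"
    by (rule Bochner_Integration.integrable_bound[OF wS]) (use le1 in auto)
  then have wf: "integrable P (\<lambda>x. w x / f x)"
    unfolding P using fnn by (subst integrable_density) auto
  have "(\<integral>x. w x / f x \<partial>P) = (\<integral>x. f x * (w x / f x) \<partial>S)"
    unfolding P using fnn by (subst integral_density) auto
  also have "\<dots> \<le> (\<integral>x. w x \<partial>S)"
    using le1 wnn fnn by (intro integral_mono_AE' wS AE_I2) auto
  finally have "0 \<le> (\<integral>x. w x - w x / f x \<partial>P)"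
    using eq wP wf by simp
  also have "\<dots> \<le> (\<integral>x. w x * ln (f x) \<partial>P)"
  proof (rule integral_mono_AE)
    show "integrable P (\<lambda>x. w x * ln (f x))"
    proof (rule Bochner_Integration.integrable_bound)
      show "integrable P (\<lambda>x. B * ln (f x))" using int by simp
      show "AE x in P. norm (w x * ln (f x)) \<le> norm (B * ln (f x))"
      proof (rule AE_I2)
        fix x
        have "\<bar>w x\<bar> \<le> \<bar>B\<bar>" using wnn[of x] wB[of x] by simp
        then show "norm (w x * ln (f x)) \<le> norm (B * ln (f x))"
          by (simp add: abs_mult mult_right_mono)
      qed
    qed measurable
    have "AE x in P. 0 < f x"
      unfolding P by (subst AE_density) auto
    then show "AE x in P. w x - w x / f x \<le> w x * ln (f x)"
    proof eventually_elim
      case (elim x)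
      have "1 - 1 / f x \<le> ln (f x)"
        using ln_le_minus_one[of "1 / f x"] elim by (simp add: ln_div)
      then have "w x * (1 - 1 / f x) \<le> w x * ln (f x)"
        using wnn by (intro mult_left_mono) auto
      then show ?case by (simp add: algebra_simps)
    qed
  qed (use wP wf in auto)
  finally show ?thesis .
qed

section \<open>Mutual information under a dominated input law\<close>

lemma dominated_density:
  fixes M N :: "'a measure"
  assumes M: "finite_measure M" and N: "finite_measure N" and sets: "sets N = sets M"
    and \<alpha>: "0 < \<alpha>" and le: "\<And>A. A \<in> sets M \<Longrightarrow> ennreal \<alpha> * emeasure N A \<le> emeasure M A"
  obtains g :: "'a \<Rightarrow> real" where "g \<in> borel_measurable M" "\<And>x. 0 \<le> g x" "\<And>x. \<alpha> * g x \<le> 1"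
    "N = density M g"
proof -
  interpret M: finite_measure M by fact
  interpret N: finite_measure N by fact
  have ac: "absolutely_continuous M N"
    unfolding absolutely_continuous_def
  proof
    fix A assume "A \<in> null_sets M"
    then show "A \<in> null_sets N"
      using le[of A] \<alpha> sets by (auto simp: null_sets_def)
  qed
  define D where "D = RN_deriv M N"
  have D [measurable]: "D \<in> borel_measurable M" by (simp add: D_def)
  have N_eq: "density M D = N"
    unfolding D_def by (rule M.density_RN_deriv[OF ac sets])
  \<comment> \<open>On \<open>A\<close> the desired bound fails. Integrating the excess
    \<open>\<alpha> D - 1\<close> over \<open>A\<close> gives \<open>\<alpha> N(A) - M(A)\<close>,
    which is 0 in truncated subtraction by domination; so \<open>A\<close> is a null set.\<close>
  define A where "A = {x \<in> space M. 1 < ennreal \<alpha> * D x}"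
  have A [measurable]: "A \<in> sets M" unfolding A_def by measurable
  let ?f = "\<lambda>x. ennreal \<alpha> * D x * indicator A x"
  have "(\<integral>\<^sup>+x. ?f x - indicator A x \<partial>M) = (\<integral>\<^sup>+x. ?f x \<partial>M) - (\<integral>\<^sup>+x. indicator A x \<partial>M)"
    by (rule nn_integral_diff)
      (auto simp: M.emeasure_finite A_def split: split_indicator)
  also have "(\<integral>\<^sup>+x. ?f x \<partial>M) = ennreal \<alpha> * emeasure N A"
    unfolding N_eq[symmetric] by (simp add: emeasure_density nn_integral_cmult mult.assoc)
  also have "ennreal \<alpha> * emeasure N A - (\<integral>\<^sup>+x. indicator A x \<partial>M) = 0"
    using le[OF A] by (intro diff_eq_0_ennreal) (auto simp: N.emeasure_eq_measure ennreal_mult_less_top)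
  finally have "AE x in M. ?f x - indicator A x = 0"
    by (subst (asm) nn_integral_0_iff_AE) auto
  then have bound: "AE x in M. ennreal \<alpha> * D x \<le> 1"
    using AE_space
  proof eventually_elim
    case (elim x)
    then show ?case
      by (cases "x \<in> A") (auto simp: A_def diff_eq_0_iff_ennreal not_less)
  qed
  \<comment> \<open>Truncation changes \<open>D\<close> only on a null set and makes the bound hold
    at every point, as the pointwise hypotheses of \<open>weighted_gibbs\<close> require.\<close>
  let ?g = "\<lambda>x. min (1 / \<alpha>) (enn2real (D x))"
  have "AE x in M. ennreal (?g x) = D x"
    using bound
  proof eventually_elim
    case (elim x)
    then have "D x \<noteq> \<top>" using \<alpha> by (auto simp: ennreal_mult_top top_unique)
    then obtain d where d: "0 \<le> d" "D x = ennreal d" by (cases "D x") auto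
    then have "\<alpha> * d \<le> 1" using elim \<alpha> by (simp add: ennreal_mult'[symmetric])
    then have "d \<le> 1 / \<alpha>" using \<alpha> by (simp add: field_simps)
    then show ?case using d by (simp add: min_def)
  qed
  then have "density M (\<lambda>x. ennreal (?g x)) = density M D"
    by (intro density_cong) auto
  then show ?thesis
    using \<alpha> N_eq by (intro that[of ?g]) (auto simp: min_def field_simps)
qed

lemma joint_law_density:
  fixes K :: "'a::second_countable_topology \<Rightarrow> 'b::second_countable_topology measure"
  assumes \<pi>: "\<pi> \<in> prob_measures" and \<nu>: "\<nu> \<in> prob_measures" and K: "K \<in> markov_kernels"
    and g [measurable]: "g \<in> borel_measurable borel" and eq: "\<nu> = density \<pi> g"
  shows "joint_law \<nu> K = density (joint_law \<pi> K) (\<lambda>p. g (fst p))"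
proof (rule measure_eqI)
  fix A assume "A \<in> sets (joint_law \<nu> K)"
  then have A [measurable]: "A \<in> sets (borel \<Otimes>\<^sub>M borel)"
    by (simp add: joint_law_prob(2)[OF \<nu> K])
  note [measurable_cong] = joint_law_prob(2)[OF \<pi> K] joint_law_prob(2)[OF \<nu> K]
    prob_measuresD(2)[OF \<pi>]
  have Ks [measurable_cong]: "sets (K x) = sets borel" for x
    using kernel_prob_measures[OF K] by (rule prob_measuresD)
  have Km [measurable]: "K \<in> borel \<rightarrow>\<^sub>M subprob_algebra borel"
    using K by (rule measurable_prob_algebraD)
  have m [measurable]: "(\<lambda>x. \<integral>\<^sup>+u. indicator A (x, u) \<partial>K x) \<in> borel_measurable borel"
    by (rule nn_integral_measurable_subprob_algebra2[where N=borel]) simp_all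
  have "emeasure (joint_law \<nu> K) A = (\<integral>\<^sup>+p. indicator A p \<partial>joint_law \<nu> K)"
    by (subst nn_integral_indicator) (auto simp: joint_law_prob(2)[OF \<nu> K])
  also have "\<dots> = (\<integral>\<^sup>+x. (\<integral>\<^sup>+u. indicator A (x, u) \<partial>K x) \<partial>\<nu>)"
    by (rule nn_integral_joint_law[OF \<nu> K]) measurable
  also have "\<dots> = (\<integral>\<^sup>+x. g x * (\<integral>\<^sup>+u. indicator A (x, u) \<partial>K x) \<partial>\<pi>)"
    unfolding eq by (rule nn_integral_density) measurable
  also have "\<dots> = (\<integral>\<^sup>+x. (\<integral>\<^sup>+u. g x * indicator A (x, u) \<partial>K x) \<partial>\<pi>)"
    by (intro nn_integral_cong nn_integral_cmult[symmetric]) measurable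
  also have "\<dots> = (\<integral>\<^sup>+p. g (fst p) * indicator A p \<partial>joint_law \<pi> K)"
    by (subst nn_integral_joint_law[OF \<pi> K]) auto
  also have "\<dots> = emeasure (density (joint_law \<pi> K) (\<lambda>p. g (fst p))) A"
    by (subst emeasure_density) auto
  finally show "emeasure (joint_law \<nu> K) A = emeasure (density (joint_law \<pi> K) (\<lambda>p. g (fst p))) A" .
qed (simp add: joint_law_prob(2)[OF \<pi> K] joint_law_prob(2)[OF \<nu> K])

text \<open>
  With \<open>f\<close>, \<open>g\<close>, \<open>k\<close> the densities of \<open>\<pi> \<otimes> K\<close>, \<open>\<nu>\<close>, \<open>\<nu>K\<close> relative to \<open>\<pi> \<otimes> \<pi>K\<close>, \<open>\<pi>\<close>, \<open>\<pi>K\<close>, the density of \<open>\<nu> \<otimes> K\<close>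
  relative to \<open>\<nu> \<otimes> \<nu>K\<close> is \<open>f / k\<close>. Dropping \<open>ln k\<close> and replacing the weight \<open>\<alpha> g\<close> of \<open>ln f\<close> by \<open>1\<close>
  both only increase the integral.
\<close>
lemma mutual_info_dominated:
  fixes K :: "'a::second_countable_topology \<Rightarrow> 'b::second_countable_topology measure"
  assumes \<pi>: "\<pi> \<in> prob_measures" and \<nu>: "\<nu> \<in> prob_measures" and K: "K \<in> markov_kernels"
    and \<alpha>: "0 < \<alpha>" and le: "\<And>A. A \<in> sets borel \<Longrightarrow> ennreal \<alpha> * emeasure \<nu> A \<le> emeasure \<pi> A"
    and info: "mutual_info \<pi> K \<le> ereal r"
  shows "mutual_info \<nu> K \<le> ereal (r / \<alpha>)"
proof -
  define M N where "M = \<pi> \<bind> K" and "N = \<nu> \<bind> K"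
  define P P' where "P = joint_law \<pi> K" and "P' = joint_law \<nu> K"
  define S T where "S = \<pi> \<Otimes>\<^sub>M M" and "T = \<nu> \<Otimes>\<^sub>M N"
  have MN: "M \<in> prob_measures" "N \<in> prob_measures"
    unfolding M_def N_def by (rule bind_prob_measures[OF _ K], fact)+
  interpret \<pi>: prob_space \<pi> by (rule prob_measuresD[OF \<pi>])
  interpret \<nu>: prob_space \<nu> by (rule prob_measuresD[OF \<nu>])
  interpret M: prob_space M by (rule prob_measuresD[OF MN(1)])
  interpret N: prob_space N by (rule prob_measuresD[OF MN(2)])
  interpret P: prob_space P unfolding P_def by (rule joint_law_prob[OF \<pi> K])
  interpret P': prob_space P' unfolding P'_def by (rule joint_law_prob[OF \<nu> K])
  interpret PS: pair_prob_space \<pi> M ..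
  interpret PT: pair_prob_space \<nu> N ..
  interpret S: prob_space S unfolding S_def by (rule PS.prob_space_axioms)
  interpret T: prob_space T unfolding T_def by (rule PT.prob_space_axioms)
  note sets_eq [measurable_cong] = prob_measuresD(2)[OF \<pi>] prob_measuresD(2)[OF \<nu>]
    prob_measuresD(2)[OF MN(1)] prob_measuresD(2)[OF MN(2)]
  have sets_joint [measurable_cong]: "sets P = sets (borel \<Otimes>\<^sub>M borel)"
      "sets P' = sets (borel \<Otimes>\<^sub>M borel)" "sets S = sets (borel \<Otimes>\<^sub>M borel)"
      "sets T = sets (borel \<Otimes>\<^sub>M borel)"
    unfolding P_def P'_def S_def T_def using joint_law_prob(2)[OF \<pi> K] joint_law_prob(2)[OF \<nu> K]
    by (auto intro!: sets_pair_measure_cong sets_eq)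
  have \<pi>_distr: "distr P borel fst = \<pi>" and M_distr: "distr P borel snd = M"
    and N_distr: "distr P' borel snd = N"
    unfolding P_def P'_def M_def N_def
    by (intro distr_joint_law_fst distr_joint_law_snd \<pi> \<nu> K)+

  have "relative_entropy P S \<le> ereal r"
    using info by (simp add: mutual_info_def P_def S_def M_def)
  \<comment> \<open>A real bound excludes the value \<infinity> assigned when absolute continuity
    fails.\<close>
  then have ac: "absolutely_continuous S P" by (auto simp: relative_entropy_def split: if_splits)
  define f where "f p = enn2real (RN_deriv S P p)" for p
  have f [measurable]: "f \<in> borel_measurable (borel \<Otimes>\<^sub>M borel)"
  proof -
    have "f \<in> borel_measurable S" unfolding f_def[abs_def] by measurable
    then show ?thesis using measurable_cong_sets[OF sets_joint(3) refl, of borel] by simp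
  qed
  have fnn: "0 \<le> f p" for p by (simp add: f_def)
  have P_eq: "P = density S f"
  proof -
    have "AE p in S. RN_deriv S P p \<noteq> \<infinity>"
      by (rule S.RN_deriv_finite[OF _ ac]) (simp_all add: sets_joint P.sigma_finite_measure_axioms)
    then have "AE p in S. ennreal (f p) = RN_deriv S P p"
      by eventually_elim (simp add: f_def less_top)
    then have "density S f = density S (RN_deriv S P)"
      by (intro density_cong) auto
    also have "\<dots> = P" by (rule S.density_RN_deriv[OF ac]) (simp add: sets_joint)
    finally show ?thesis ..
  qed
  have "ext_integral P (\<lambda>p. ereal (ln (f p))) \<le> ereal r"
    using \<open>relative_entropy P S \<le> ereal r\<close>
      relative_entropy_density[OF S.prob_space_axioms _ fnn P_eq] by simp
  moreover have "(\<integral>\<^sup>+ p. ennreal (- ln (f p)) \<partial>P) < \<infinity>"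
    by (rule order.strict_trans1[OF nn_integral_neg_ln_density_le[OF S.prob_space_axioms _ fnn P_eq]])
      simp_all
  ultimately have intf: "integrable P (\<lambda>p. ln (f p))" and lef: "(\<integral>p. ln (f p) \<partial>P) \<le> r"
    using ext_integral_le_integrable[of "\<lambda>p. ln (f p)" P r] by simp_all

  obtain g :: "'a \<Rightarrow> real" where g': "g \<in> borel_measurable \<pi>" and gnn: "\<And>x. 0 \<le> g x"
    and gle: "\<And>x. \<alpha> * g x \<le> 1" and \<nu>_eq: "\<nu> = density \<pi> g"
    by (rule dominated_density[OF \<pi>.finite_measure_axioms \<nu>.finite_measure_axioms _ \<alpha>])
      (use le sets_eq in auto)
  have g [measurable]: "g \<in> borel_measurable borel"
    using g' measurable_cong_sets[OF sets_eq(1) refl, of borel] by simp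
  have P'_eq: "P' = density P (\<lambda>p. g (fst p))"
    unfolding P'_def P_def using \<nu>_eq by (intro joint_law_density[OF \<pi> \<nu> K]) auto

  \<comment> \<open>Domination passes to the output laws: both are second marginals, and
    \<open>P'\<close> has density \<open>g (fst p)\<close> relative to \<open>P\<close>, at most
    \<open>1 / \<alpha>\<close>.\<close>
  have leM: "ennreal \<alpha> * emeasure N A \<le> emeasure M A" if "A \<in> sets M" for A
  proof -
    have [measurable]: "A \<in> sets borel" using that sets_eq by simp
    let ?A = "snd -` A \<inter> space P"
    have [measurable]: "?A \<in> sets P" by measurable
    have sp: "space P' = space P" by (rule sets_eq_imp_space_eq) (simp add: sets_joint)
    have "ennreal \<alpha> * emeasure N A = ennreal \<alpha> * emeasure P' ?A"
      unfolding N_distr[symmetric] by (subst emeasure_distr) (auto simp: sp)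
    also have "\<dots> = (\<integral>\<^sup>+p. ennreal \<alpha> * (ennreal (g (fst p)) * indicator ?A p) \<partial>P)"
      unfolding P'_eq by (subst emeasure_density) (auto simp: nn_integral_cmult)
    also have "\<dots> \<le> (\<integral>\<^sup>+p. indicator ?A p \<partial>P)"
      using gle \<alpha> by (intro nn_integral_mono)
        (auto simp: ennreal_mult'[symmetric] gnn split: split_indicator)
    also have "\<dots> = emeasure M A"
      unfolding M_distr[symmetric] by (subst emeasure_distr) auto
    finally show ?thesis .
  qed
  obtain k :: "'b \<Rightarrow> real" where k': "k \<in> borel_measurable M" and knn: "\<And>x. 0 \<le> k x"
    and kle: "\<And>x. \<alpha> * k x \<le> 1" and N_eq: "N = density M k"
    by (rule dominated_density[OF M.finite_measure_axioms N.finite_measure_axioms _ \<alpha> leM])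
      (use sets_eq in auto)
  have k [measurable]: "k \<in> borel_measurable borel"
    using k' measurable_cong_sets[OF sets_eq(3) refl, of borel] by simp

  have T_eq: "T = density S (\<lambda>p. ennreal (g (fst p) * k (snd p)))"
  proof -
    have "T = density S (\<lambda>(x, y). ennreal (g x) * ennreal (k y))"
      unfolding T_def S_def \<nu>_eq N_eq
    proof (rule pair_measure_density)
      show "sigma_finite_measure (density M (\<lambda>x. ennreal (k x)))"
        using N.sigma_finite_measure_axioms by (simp add: N_eq)
    qed (auto intro: M.sigma_finite_measure_axioms)
    then show ?thesis
      by (simp add: split_beta' ennreal_mult' gnn)
  qed
  have P'_S: "P' = density S (\<lambda>p. ennreal (f p * g (fst p)))"
    unfolding P'_eq P_eq by (subst density_density_eq) (auto simp: ennreal_mult' fnn)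
  have "AE u in N. 0 < k u"
    unfolding N_eq by (subst AE_density) auto
  then have kpos: "AE p in P'. 0 < k (snd p)"
    unfolding N_distr[symmetric] by (subst (asm) AE_distr_iff) auto
  have fpos: "AE p in P'. 0 < f p"
    unfolding P'_S using gnn fnn by (subst AE_density) (auto simp: less_le)

  let ?q = "\<lambda>p. f p / k (snd p)"
  have qnn: "0 \<le> ?q p" for p using fnn knn by simp
  have P'_T: "P' = density T ?q"
  proof -
    \<comment> \<open>Where \<open>k\<close> vanishes the left side is 0. By \<open>kpos\<close> the
      product \<open>f * g\<close> vanishes there too, up to an \<open>S\<close>-null set.\<close>
    have "AE p in S. ennreal (g (fst p) * k (snd p)) * ennreal (?q p) = ennreal (f p * g (fst p))"
      using kpos unfolding P'_S
      by (subst (asm) AE_density)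
        (auto elim!: eventually_mono simp: ennreal_mult'[symmetric] gnn knn fnn less_le)
    then show ?thesis
      unfolding P'_S T_eq by (subst density_density_eq) (auto intro!: density_cong elim: eventually_mono)
  qed
  have bound: "norm (g (fst p) * ln (f p)) \<le> norm (1 / \<alpha> * ln (f p))" for p
  proof -
    have "g (fst p) \<le> 1 / \<alpha>" using gle[of "fst p"] \<alpha> by (simp add: field_simps)
    then show ?thesis using gnn[of "fst p"] \<alpha>
      by (auto simp: abs_mult simp del: times_divide_eq_left intro!: mult_right_mono)
  qed
  have intgf: "integrable P (\<lambda>p. g (fst p) * ln (f p))"
    by (rule Bochner_Integration.integrable_bound[of P "\<lambda>p. 1 / \<alpha> * ln (f p)"])
      (use intf bound in \<open>auto intro!: AE_I2\<close>)
  then have int1: "integrable P' (\<lambda>p. ln (f p))"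
    unfolding P'_eq using gnn by (subst integrable_density) auto
  have eq1: "(\<integral>p. ln (f p) \<partial>P') = (\<integral>p. g (fst p) * ln (f p) \<partial>P)"
    unfolding P'_eq using gnn by (subst integral_density) auto
  \<comment> \<open>The positive part is bounded because \<open>k \<le> 1 / \<alpha>\<close>; the
    absolute value also covers \<open>k u = 0\<close>, where \<open>ln 0 = 0\<close>. The negative
    part falls under \<open>nn_integral_neg_ln_density_le\<close>.\<close>
  have intk: "integrable N (\<lambda>u. ln (k u))"
  proof -
    have "ln (k u) \<le> \<bar>ln (1 / \<alpha>)\<bar>" for u
    proof (cases "k u = 0")
      case False
      then have "0 < k u" using knn[of u] by simp
      moreover have "k u \<le> 1 / \<alpha>" using kle[of u] \<alpha> by (simp add: field_simps)
      ultimately have "ln (k u) \<le> ln (1 / \<alpha>)" using \<alpha> by (subst ln_le_cancel_iff) auto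
      then show ?thesis by linarith
    qed simp
    then have "(\<integral>\<^sup>+ u. ennreal (ln (k u)) \<partial>N) \<le> (\<integral>\<^sup>+ u. ennreal \<bar>ln (1 / \<alpha>)\<bar> \<partial>N)"
      by (intro nn_integral_mono ennreal_leI)
    also have "\<dots> < \<infinity>" by (simp add: N.emeasure_space_1)
    finally have "(\<integral>\<^sup>+ u. ennreal (ln (k u)) \<partial>N) < \<infinity>" .
    moreover have "(\<integral>\<^sup>+ u. ennreal (- ln (k u)) \<partial>N) \<le> 1"
      by (rule nn_integral_neg_ln_density_le[OF M.prob_space_axioms _ knn N_eq]) measurable
    ultimately show ?thesis
      by (auto simp: real_integrable_def top_unique)
  qed
  then have int2: "integrable P' (\<lambda>p. ln (k (snd p)))"
    unfolding N_distr[symmetric] by (subst (asm) integrable_distr_eq) auto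
  have "mutual_info \<nu> K = relative_entropy P' T"
    by (simp add: mutual_info_def P'_def T_def N_def)
  also have "\<dots> = ext_integral P' (\<lambda>p. ereal (ln (?q p)))"
    by (rule relative_entropy_density[OF T.prob_space_axioms _ qnn P'_T]) measurable
  also have "\<dots> = ereal (\<integral>p. ln (f p) - ln (k (snd p)) \<partial>P')"
  proof (rule ext_integral_eq_integral)
    show "integrable P' (\<lambda>p. ln (f p) - ln (k (snd p)))"
      using int1 int2 by simp
    show "AE p in P'. ereal (ln (?q p)) = ereal (ln (f p) - ln (k (snd p)))"
      using fpos kpos by eventually_elim (simp add: ln_div)
  qed measurable
  finally have I: "mutual_info \<nu> K = ereal (\<integral>p. ln (f p) - ln (k (snd p)) \<partial>P')" .

  \<comment> \<open>This is the nonnegativity of the relative entropy of \<open>N\<close> with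
    respect to \<open>M\<close>.\<close>
  have "0 \<le> (\<integral>u. 1 * ln (k u) \<partial>N)"
    by (rule weighted_gibbs[OF M.prob_space_axioms N_eq N.prob_space_axioms _ knn, where B=1])
      (auto simp: M.prob_space N.prob_space intk)
  then have k0: "0 \<le> (\<integral>p. ln (k (snd p)) \<partial>P')"
    unfolding N_distr[symmetric] by (subst (asm) integral_distr) auto

  \<comment> \<open>The weight depends on the first coordinate alone, and \<open>P\<close> and
    \<open>S\<close> share the first marginal \<pi>; this gives the equality of integrals that
    \<open>weighted_gibbs\<close> demands.\<close>
  have "0 \<le> (\<integral>p. (1 - \<alpha> * g (fst p)) * ln (f p) \<partial>P)"
  proof (rule weighted_gibbs[OF S.prob_space_axioms P_eq P.prob_space_axioms _ fnn, where B=1])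
    have "distr S \<pi> fst = \<pi>"
      unfolding S_def by (rule M.distr_pair_fst)
    then have "(\<integral>p. (1 - \<alpha> * g (fst p)) \<partial>S) = (\<integral>x. (1 - \<alpha> * g x) \<partial>\<pi>)"
      using integral_distr[of fst S \<pi> "\<lambda>x. 1 - \<alpha> * g x"] by simp
    also have "\<dots> = (\<integral>p. (1 - \<alpha> * g (fst p)) \<partial>P)"
      by (subst \<pi>_distr[symmetric], subst integral_distr) auto
    finally show "(\<integral>p. (1 - \<alpha> * g (fst p)) \<partial>P) = (\<integral>p. (1 - \<alpha> * g (fst p)) \<partial>S)" ..
  qed (use gle gnn \<alpha> intf in auto)
  also have "\<dots> = (\<integral>p. ln (f p) \<partial>P) - \<alpha> * (\<integral>p. ln (f p) \<partial>P')"
    using intf intgf by (simp add: left_diff_distrib mult.assoc eq1)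
  finally have "\<alpha> * (\<integral>p. ln (f p) \<partial>P') \<le> r" using lef by simp
  moreover have "0 \<le> \<alpha> * (\<integral>p. ln (k (snd p)) \<partial>P')" using k0 \<alpha> by simp
  ultimately have "\<alpha> * (\<integral>p. ln (f p) - ln (k (snd p)) \<partial>P') \<le> r"
    using int1 int2 by (simp add: right_diff_distrib)
  then have "(\<integral>p. ln (f p) - ln (k (snd p)) \<partial>P') \<le> r / \<alpha>"
    using \<alpha> by (simp only: pos_le_divide_eq mult.commute)
  then show ?thesis by (simp only: I ereal_less_eq)
qed

section \<open>Discounted occupation measures\<close>

text \<open>State and control are independent, so the joint law is the product law and the
  log-density is 0. Such a kernel is admissible at every rate \<open>R \<ge> 0\<close>, whatever the
  state law.\<close>

lemma mutual_info_const:
  fixes \<kappa> :: "'b::second_countable_topology measure" and \<nu> :: "'a::second_countable_topology measure"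
  assumes \<nu>: "\<nu> \<in> prob_measures" and \<kappa>: "\<kappa> \<in> prob_measures"
  shows "mutual_info \<nu> (\<lambda>_. \<kappa>) = 0"
proof -
  interpret \<nu>: prob_space \<nu> by (rule prob_measuresD[OF \<nu>])
  interpret \<kappa>: prob_space \<kappa> by (rule prob_measuresD[OF \<kappa>])
  interpret P: pair_prob_space \<nu> \<kappa> ..
  have K: "(\<lambda>_::'a. \<kappa>) \<in> markov_kernels" using \<kappa> by (rule measurable_const)
  have sets: "sets (\<nu> \<Otimes>\<^sub>M \<kappa>) = sets (borel \<Otimes>\<^sub>M borel)"
    by (intro sets_pair_measure_cong prob_measuresD \<nu> \<kappa>)
  have bind: "\<nu> \<bind> (\<lambda>_. \<kappa>) = \<kappa>"
    by (rule bind_const'[OF \<nu>.prob_space_axioms \<kappa>.subprob_space_axioms])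
  have joint: "joint_law \<nu> (\<lambda>_. \<kappa>) = \<nu> \<Otimes>\<^sub>M \<kappa>"
  proof (rule measure_eqI)
    fix A assume "A \<in> sets (joint_law \<nu> (\<lambda>_. \<kappa>))"
    then have A [measurable]: "A \<in> sets (borel \<Otimes>\<^sub>M borel)" by (simp add: joint_law_prob(2)[OF \<nu> K])
    note [measurable_cong] = sets
    have "emeasure (joint_law \<nu> (\<lambda>_. \<kappa>)) A = (\<integral>\<^sup>+p. indicator A p \<partial>joint_law \<nu> (\<lambda>_. \<kappa>))"
      using joint_law_prob(2)[OF \<nu> K] by (subst nn_integral_indicator) auto
    also have "\<dots> = (\<integral>\<^sup>+x. (\<integral>\<^sup>+u. indicator A (x, u) \<partial>\<kappa>) \<partial>\<nu>)"
      by (rule nn_integral_joint_law[OF \<nu> K]) measurable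
    also have "\<dots> = (\<integral>\<^sup>+p. indicator A p \<partial>(\<nu> \<Otimes>\<^sub>M \<kappa>))"
      by (rule \<kappa>.nn_integral_fst) measurable
    also have "\<dots> = emeasure (\<nu> \<Otimes>\<^sub>M \<kappa>) A"
      by (subst nn_integral_indicator) (auto simp: sets)
    finally show "emeasure (joint_law \<nu> (\<lambda>_. \<kappa>)) A = emeasure (\<nu> \<Otimes>\<^sub>M \<kappa>) A" .
  qed (simp add: joint_law_prob(2)[OF \<nu> K] sets)
  have "relative_entropy (\<nu> \<Otimes>\<^sub>M \<kappa>) (\<nu> \<Otimes>\<^sub>M \<kappa>) = ext_integral (\<nu> \<Otimes>\<^sub>M \<kappa>) (\<lambda>p. ereal (ln ((\<lambda>_. 1) p)))"
    by (rule relative_entropy_density[OF P.prob_space_axioms]) (simp_all add: density_1)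
  also have "\<dots> = 0"
    by (simp add: ext_integral_def integral_defined_def zero_ereal_def[symmetric] e2ennreal_ereal)
  finally show ?thesis
    by (simp add: mutual_info_def joint bind)
qed

text \<open>Carries the setwise equation in \<open>discounted_kernels\<close> over to nonnegative
  test functions, with \<rho> in the role of \<open>\<pi> \<bind> closed_loop Q K\<close>.\<close>

lemma nn_integral_discounted:
  assumes \<mu>: "\<mu> \<in> prob_measures" and \<pi>: "\<pi> \<in> prob_measures" and \<rho>: "\<rho> \<in> prob_measures"
    and \<beta>: "0 < \<beta>" "\<beta> < 1"
    and eq: "\<And>A. A \<in> sets borel \<Longrightarrow> measure \<pi> A = (1 - \<beta>) * measure \<mu> A + \<beta> * measure \<rho> A"
    and f: "f \<in> borel_measurable borel"
  shows "(\<integral>\<^sup>+x. f x \<partial>\<pi>) = ennreal (1 - \<beta>) * (\<integral>\<^sup>+x. f x \<partial>\<mu>) + ennreal \<beta> * (\<integral>\<^sup>+x. f x \<partial>\<rho>)"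
proof -
  let ?B = "measure_pmf (bernoulli_pmf \<beta>)" and ?k = "\<lambda>b. if b then \<rho> else \<mu>"
  interpret \<mu>: prob_space \<mu> by (rule prob_measuresD[OF \<mu>])
  interpret \<rho>: prob_space \<rho> by (rule prob_measuresD[OF \<rho>])
  interpret \<pi>: prob_space \<pi> by (rule prob_measuresD[OF \<pi>])
  have k: "?k \<in> ?B \<rightarrow>\<^sub>M subprob_algebra borel"
    using prob_measuresD(2)[OF \<mu>] prob_measuresD(2)[OF \<rho>] \<mu>.subprob_space_axioms \<rho>.subprob_space_axioms
    by (auto simp: space_subprob_algebra)
  txt \<open>A two-point mixture is a bind along a Bernoulli variable, so no induction over \<open>f\<close> is needed.\<close>
  have "\<pi> = ?B \<bind> ?k"
  proof (rule measure_eqI)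
    show "sets \<pi> = sets (?B \<bind> ?k)"
      using prob_measuresD(2)[OF \<pi>] prob_measuresD(2)[OF \<mu>] prob_measuresD(2)[OF \<rho>]
      by (subst sets_bind[where N=borel]) simp_all
    fix A assume "A \<in> sets \<pi>"
    then have A: "A \<in> sets borel" using prob_measuresD(2)[OF \<pi>] by simp
    have "emeasure \<pi> A = ennreal ((1 - \<beta>) * measure \<mu> A + \<beta> * measure \<rho> A)"
      by (simp add: \<pi>.emeasure_eq_measure eq[OF A])
    also have "\<dots> = emeasure \<rho> A * ennreal \<beta> + emeasure \<mu> A * ennreal (1 - \<beta>)"
      using \<beta> by (simp add: ennreal_plus ennreal_mult \<mu>.emeasure_eq_measure \<rho>.emeasure_eq_measure
          mult.commute add.commute)
    also have "\<dots> = emeasure (?B \<bind> ?k) A"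
      using \<beta> by (subst emeasure_bind[OF _ k A]) simp_all
    finally show "emeasure \<pi> A = emeasure (?B \<bind> ?k) A" .
  qed
  then have "(\<integral>\<^sup>+x. f x \<partial>\<pi>) = (\<integral>\<^sup>+b. (\<integral>\<^sup>+x. f x \<partial>?k b) \<partial>?B)"
    using nn_integral_bind[OF f k] by simp
  also have "\<dots> = ennreal (1 - \<beta>) * (\<integral>\<^sup>+x. f x \<partial>\<mu>) + ennreal \<beta> * (\<integral>\<^sup>+x. f x \<partial>\<rho>)"
    using \<beta> by (simp add: mult.commute add.commute)
  finally show ?thesis .
qed

text \<open>Induction on \<open>n\<close> with \<open>f\<close> generalized. After time 0 is split
  off, the rest of the sum is \<beta> times the shorter sum for \<open>?T\<close>, the mean of
  \<open>f\<close> one closed-loop step ahead. The hypothesis bounds it by the integral of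
  \<open>?T\<close> under \<pi>, and the fixed-point equation for \<pi> recombines the two
  terms.\<close>

lemma discounted_occupation_le:
  fixes Q :: "'x::second_countable_topology \<times> 'u::second_countable_topology \<Rightarrow> 'x measure"
  assumes Q: "Q \<in> markov_kernels" and \<mu>: "\<mu> \<in> prob_measures" and \<pi>: "\<pi> \<in> prob_measures"
    and \<beta>: "0 < \<beta>" "\<beta> < 1" and K: "K \<in> discounted_kernels Q \<beta> \<mu> \<pi>"
    and f: "f \<in> borel_measurable borel"
  shows "ennreal (1 - \<beta>) * (\<Sum>t<n. ennreal (\<beta> ^ t) * (\<integral>\<^sup>+x. f x \<partial>marginal_law Q \<mu> (\<lambda>_. K) t))
    \<le> (\<integral>\<^sup>+x. f x \<partial>\<pi>)"
  using f
proof (induction n arbitrary: f)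
  case (Suc n)
  note [measurable] = Suc.prems
  let ?m = "marginal_law Q \<mu> (\<lambda>_. K)" and ?L = "closed_loop Q K"
  let ?T = "\<lambda>x. \<integral>\<^sup>+y. f y \<partial>?L x"
  have K': "K \<in> markov_kernels" using K by (simp add: discounted_kernels_def)
  have L: "?L \<in> markov_kernels" by (rule closed_loop_kernel[OF Q K'])
  have [measurable]: "?L \<in> borel \<rightarrow>\<^sub>M subprob_algebra borel"
    using L by (rule measurable_prob_algebraD)
  have T [measurable]: "?T \<in> borel_measurable borel" by measurable
  have m: "?m t \<in> prob_measures" for t using Q \<mu> K' by (rule marginal_law_prob)
  have step: "(\<integral>\<^sup>+x. ?T x \<partial>?m t) = (\<integral>\<^sup>+x. f x \<partial>?m (Suc t))" for t
    unfolding marginal_law.simps by (rule nn_integral_bind_kernel[OF m L Suc.prems, symmetric])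
  have "(\<Sum>t<Suc n. ennreal (\<beta> ^ t) * (\<integral>\<^sup>+x. f x \<partial>?m t)) =
      (\<integral>\<^sup>+x. f x \<partial>\<mu>) + ennreal \<beta> * (\<Sum>t<n. ennreal (\<beta> ^ t) * (\<integral>\<^sup>+x. ?T x \<partial>?m t))"
    unfolding sum.lessThan_Suc_shift step sum_distrib_left
    using \<beta> by (simp add: ennreal_mult' mult.assoc)
  then have "ennreal (1 - \<beta>) * (\<Sum>t<Suc n. ennreal (\<beta> ^ t) * (\<integral>\<^sup>+x. f x \<partial>?m t)) =
      ennreal (1 - \<beta>) * (\<integral>\<^sup>+x. f x \<partial>\<mu>) +
      ennreal \<beta> * (ennreal (1 - \<beta>) * (\<Sum>t<n. ennreal (\<beta> ^ t) * (\<integral>\<^sup>+x. ?T x \<partial>?m t)))"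
    by (simp only: distrib_left mult.left_commute)
  also have "\<dots> \<le> ennreal (1 - \<beta>) * (\<integral>\<^sup>+x. f x \<partial>\<mu>) + ennreal \<beta> * (\<integral>\<^sup>+x. ?T x \<partial>\<pi>)"
    by (intro add_left_mono mult_left_mono Suc.IH T) simp
  also have "(\<integral>\<^sup>+x. ?T x \<partial>\<pi>) = (\<integral>\<^sup>+x. f x \<partial>(\<pi> \<bind> ?L))"
    by (rule nn_integral_bind_kernel[OF \<pi> L Suc.prems, symmetric])
  also have "ennreal (1 - \<beta>) * (\<integral>\<^sup>+x. f x \<partial>\<mu>) + ennreal \<beta> * \<dots> = (\<integral>\<^sup>+x. f x \<partial>\<pi>)"
    using K by (intro nn_integral_discounted[OF \<mu> \<pi> bind_prob_measures[OF \<pi> L] \<beta> _ Suc.prems, symmetric])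
      (simp add: discounted_kernels_def)
  finally show ?case .
qed simp

section \<open>Discounted cost and the cost-to-go integral\<close>

lemma borel_measurable_lower_semicontinuous:
  "lower_semicontinuous c \<Longrightarrow> c \<in> borel_measurable borel"
  by (intro borel_measurableI_greater) (auto simp: lower_semicontinuous_def)

text \<open>Tonelli moves the sum out of the integral, and each summand then depends on a single
  coordinate of the path.\<close>

lemma discounted_cost_eq:
  fixes Q :: "'x::second_countable_topology \<times> 'u::second_countable_topology \<Rightarrow> 'x measure"
  assumes Q: "Q \<in> markov_kernels" and \<mu>: "\<mu> \<in> prob_measures"
    and \<Phi>: "\<And>t. \<Phi> t \<in> markov_kernels"
    and c [measurable]: "c \<in> borel_measurable (borel \<Otimes>\<^sub>M borel)" and c0: "\<And>p. 0 \<le> c p"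
    and \<beta>: "0 \<le> \<beta>"
  shows "discounted_cost Q c \<beta> \<mu> \<Phi> =
    enn2ereal (\<Sum>t. ennreal (\<beta> ^ t) * (\<integral>\<^sup>+p. ennreal (c p) \<partial>joint_law (marginal_law Q \<mu> \<Phi> t) (\<Phi> t)))"
proof -
  interpret IT: Ionescu_Tulcea "control_step Q \<mu> \<Phi>"
      "\<lambda>_. borel \<Otimes>\<^sub>M borel :: ('x \<times> 'u) measure"
    using Q \<mu> \<Phi> by (rule Ionescu_Tulcea_control_step)
  have [measurable_cong]: "sets (process_law Q \<mu> \<Phi>) = sets (PiM UNIV (\<lambda>_. borel \<Otimes>\<^sub>M borel))"
    unfolding process_law_def by (rule IT.PF.sets_lim)
  have m: "marginal_law Q \<mu> \<Phi> t \<in> prob_measures" for t using Q \<mu> \<Phi> by (rule marginal_law_prob)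
  have "(\<integral>\<^sup>+ \<omega>. (\<Sum>t. ennreal (\<beta> ^ t * c (\<omega> t))) \<partial>process_law Q \<mu> \<Phi>) =
      (\<Sum>t. \<integral>\<^sup>+ \<omega>. ennreal (\<beta> ^ t * c (\<omega> t)) \<partial>process_law Q \<mu> \<Phi>)"
    by (rule nn_integral_suminf) measurable
  also have "\<dots> = (\<Sum>t. ennreal (\<beta> ^ t) * (\<integral>\<^sup>+p. ennreal (c p) \<partial>joint_law (marginal_law Q \<mu> \<Phi> t) (\<Phi> t)))"
  proof (rule suminf_cong)
    fix t
    note [measurable_cong] = joint_law_prob(2)[OF m \<Phi>]
    have "(\<integral>\<^sup>+ \<omega>. ennreal (\<beta> ^ t * c (\<omega> t)) \<partial>process_law Q \<mu> \<Phi>) =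
        (\<integral>\<^sup>+p. ennreal (\<beta> ^ t * c p) \<partial>joint_law (marginal_law Q \<mu> \<Phi> t) (\<Phi> t))"
      by (rule nn_integral_process_law[OF Q \<mu> \<Phi>]) measurable
    also have "\<dots> = (\<integral>\<^sup>+p. ennreal (\<beta> ^ t) * ennreal (c p) \<partial>joint_law (marginal_law Q \<mu> \<Phi> t) (\<Phi> t))"
      using \<beta> by (simp add: ennreal_mult')
    also have "\<dots> = ennreal (\<beta> ^ t) * (\<integral>\<^sup>+p. ennreal (c p) \<partial>joint_law (marginal_law Q \<mu> \<Phi> t) (\<Phi> t))"
      by (rule nn_integral_cmult) measurable
    finally show "(\<integral>\<^sup>+ \<omega>. ennreal (\<beta> ^ t * c (\<omega> t)) \<partial>process_law Q \<mu> \<Phi>) = \<dots>" .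
  qed
  finally show ?thesis by (simp add: discounted_cost_def)
qed

text \<open>Averaging \<open>Qh\<close> over the joint law gives the integral of \<open>h\<close>
  under the law one step after \<pi>, which the fixed-point equation expresses through \<pi> and
  \<mu>.\<close>

lemma ext_integral_cost_to_go:
  fixes Q :: "'x::second_countable_topology \<times> 'u::second_countable_topology \<Rightarrow> 'x measure"
  assumes Q: "Q \<in> markov_kernels" and \<mu>: "\<mu> \<in> prob_measures" and \<pi>: "\<pi> \<in> prob_measures"
    and \<beta>: "0 < \<beta>" "\<beta> < 1" and K: "K \<in> discounted_kernels Q \<beta> \<mu> \<pi>"
    and h: "integrable \<pi> h" and c: "integrable (joint_law \<pi> K) c"
    and meas: "(\<lambda>p. ereal (c p) + ereal \<beta> * kernel_apply Q h p) \<in> borel_measurable (joint_law \<pi> K)"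
  shows "ext_integral (joint_law \<pi> K) (\<lambda>p. ereal (c p) + ereal \<beta> * kernel_apply Q h p) =
    ereal ((\<integral>p. c p \<partial>joint_law \<pi> K) + ((\<integral>x. h x \<partial>\<pi>) - (1 - \<beta>) * (\<integral>x. h x \<partial>\<mu>)))"
proof -
  let ?P = "joint_law \<pi> K" and ?\<rho> = "\<pi> \<bind> closed_loop Q K"
  have K': "K \<in> markov_kernels" using K by (simp add: discounted_kernels_def)
  have \<rho>: "?\<rho> \<in> prob_measures"
    by (rule bind_prob_measures[OF \<pi> closed_loop_kernel[OF Q K']])
  have h' [measurable]: "h \<in> borel_measurable borel"
    using borel_measurable_integrable[OF h]
    by (subst (asm) measurable_cong_sets[OF prob_measuresD(2)[OF \<pi>] refl])
  have Q': "Q \<in> borel \<Otimes>\<^sub>M borel \<rightarrow>\<^sub>M prob_algebra borel"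
    using Q by (simp add: borel_prod)
  have [measurable]: "Q \<in> borel \<Otimes>\<^sub>M borel \<rightarrow>\<^sub>M subprob_algebra borel"
    using Q' by (rule measurable_prob_algebraD)
  note [measurable_cong] = joint_law_prob(2)[OF \<pi> K'] prob_measuresD(2)[OF \<pi>]
    prob_measuresD(2)[OF \<mu>] prob_measuresD(2)[OF \<rho>]
  have split: "(\<integral>\<^sup>+x. f x \<partial>\<pi>) = ennreal (1 - \<beta>) * (\<integral>\<^sup>+x. f x \<partial>\<mu>) + ennreal \<beta> * (\<integral>\<^sup>+x. f x \<partial>?\<rho>)"
    if "f \<in> borel_measurable borel" for f
    using K that by (intro nn_integral_discounted[OF \<mu> \<pi> \<rho> \<beta>]) (simp add: discounted_kernels_def)
  \<comment> \<open>Both weights \<open>1 - \<beta>\<close> and \<beta> are positive, so finiteness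
    under the mixture \<pi> forces finiteness under each component. This yields integrability of
    \<open>h\<close> under \<mu> and \<open>?\<rho>\<close>.\<close>
  have *: "(\<integral>\<^sup>+x. ennreal (f x) \<partial>\<pi>) < \<infinity> \<Longrightarrow>
      (\<integral>\<^sup>+x. ennreal (f x) \<partial>\<mu>) < \<infinity> \<and> (\<integral>\<^sup>+x. ennreal (f x) \<partial>?\<rho>) < \<infinity>"
    if [measurable]: "f \<in> borel_measurable borel" for f :: "'x \<Rightarrow> real"
    using \<beta> by (subst (asm) split) (auto simp: ennreal_mult_less_top)
  have fin: "(\<integral>\<^sup>+x. ennreal (h x) \<partial>\<pi>) < \<infinity>" "(\<integral>\<^sup>+x. ennreal (- h x) \<partial>\<pi>) < \<infinity>"
    using h by (auto simp: real_integrable_def less_top)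
  note fin' = fin *[OF _ fin(1)] *[OF _ fin(2)]
  have int: "integrable \<mu> h" "integrable ?\<rho> h"
    using fin' by (auto simp: real_integrable_def)
  have lin: "enn2real (\<integral>\<^sup>+x. ennreal (f x) \<partial>\<pi>) =
      (1 - \<beta>) * enn2real (\<integral>\<^sup>+x. ennreal (f x) \<partial>\<mu>) + \<beta> * enn2real (\<integral>\<^sup>+x. ennreal (f x) \<partial>?\<rho>)"
    if [measurable]: "f \<in> borel_measurable borel" and "(\<integral>\<^sup>+x. ennreal (f x) \<partial>\<pi>) < \<infinity>" for f :: "'x \<Rightarrow> real"
    using *[OF that] \<beta> by (subst split) (auto simp: enn2real_plus ennreal_mult_less_top enn2real_mult)
  have h_split: "(\<integral>x. h x \<partial>\<pi>) = (1 - \<beta>) * (\<integral>x. h x \<partial>\<mu>) + \<beta> * (\<integral>x. h x \<partial>?\<rho>)"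
    unfolding real_lebesgue_integral_def[OF h] real_lebesgue_integral_def[OF int(1)]
      real_lebesgue_integral_def[OF int(2)]
    using lin[OF _ fin(1)] lin[of "\<lambda>x. - h x", OF _ fin(2)] by (simp add: algebra_simps)
  \<comment> \<open>The positive and negative parts of \<open>h\<close> are pushed through
    \<open>Q\<close> separately. Both results are finite almost everywhere, and there
    \<open>kernel_apply Q h\<close> is their difference.\<close>
  define H where "H f p = (\<integral>\<^sup>+y. ennreal (f y) \<partial>Q p)" for f :: "'x \<Rightarrow> real" and p
  have HP: "(\<integral>\<^sup>+p. H f p \<partial>?P) = (\<integral>\<^sup>+y. ennreal (f y) \<partial>?\<rho>)"
    if [measurable]: "f \<in> borel_measurable borel" for f
    unfolding H_def by (rule nn_integral_bind_closed_loop[OF Q K' \<pi>, symmetric]) measurable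
  have Hm [measurable]: "H f \<in> borel_measurable (borel \<Otimes>\<^sub>M borel)"
    if [measurable]: "f \<in> borel_measurable borel" for f
    unfolding H_def[abs_def] by measurable
  have H: "integrable ?P (\<lambda>p. enn2real (H f p)) \<and>
      (\<integral>p. enn2real (H f p) \<partial>?P) = enn2real (\<integral>\<^sup>+y. ennreal (f y) \<partial>?\<rho>) \<and> (AE p in ?P. H f p < \<infinity>)"
    if [measurable]: "f \<in> borel_measurable borel" and "(\<integral>\<^sup>+x. ennreal (f x) \<partial>\<pi>) < \<infinity>" for f
  proof -
    have "(\<integral>\<^sup>+p. H f p \<partial>?P) < \<infinity>" using *[OF that] HP[OF that(1)] by simp
    then have ae: "AE p in ?P. H f p \<noteq> \<infinity>" by (intro nn_integral_PInf_AE) auto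
    then have eq: "AE p in ?P. ennreal (enn2real (H f p)) = H f p"
      by eventually_elim (simp add: less_top)
    have "(\<integral>\<^sup>+p. ennreal (enn2real (H f p)) \<partial>?P) = (\<integral>\<^sup>+p. H f p \<partial>?P)"
      by (rule nn_integral_cong_AE[OF eq])
    with \<open>(\<integral>\<^sup>+p. H f p \<partial>?P) < \<infinity>\<close> ae show ?thesis
      by (auto simp: HP integral_eq_nn_integral less_top intro!: integrableI_nonneg)
  qed
  note H1 = H[OF h' fin(1)] and H2 = H[of "\<lambda>x. - h x", OF _ fin(2)]
  have i: "integrable ?P (\<lambda>p. c p + \<beta> * (enn2real (H h p) - enn2real (H (\<lambda>x. - h x) p)))"
    using c H1 H2 by (intro Bochner_Integration.integrable_add integrable_mult_right
        Bochner_Integration.integrable_diff) auto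
  have "ext_integral ?P (\<lambda>p. ereal (c p) + ereal \<beta> * kernel_apply Q h p) =
      ereal (\<integral>p. c p + \<beta> * (enn2real (H h p) - enn2real (H (\<lambda>x. - h x) p)) \<partial>?P)"
  proof (rule ext_integral_eq_integral[OF meas i])
    have "AE p in ?P. H h p < \<infinity>" "AE p in ?P. H (\<lambda>x. - h x) p < \<infinity>" using H1 H2 by auto
    then show "AE p in ?P. ereal (c p) + ereal \<beta> * kernel_apply Q h p =
        ereal (c p + \<beta> * (enn2real (H h p) - enn2real (H (\<lambda>x. - h x) p)))"
    proof eventually_elim
      case (elim p)
      have "h \<in> borel_measurable (Q p)"
        using h' by (subst measurable_cong_sets[OF prob_measuresD(2)[OF kernel_prob_measures[OF Q]] refl])
      moreover obtain a b where "0 \<le> a" "0 \<le> b" "H h p = ennreal a" "H (\<lambda>x. - h x) p = ennreal b"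
        using elim by (auto simp: less_top_ennreal)
      ultimately have "kernel_apply Q h p = ereal (enn2real (H h p) - enn2real (H (\<lambda>x. - h x) p))"
        by (simp add: kernel_apply_def ext_integral_def integral_defined_def e2ennreal_ereal H_def)
      then show ?case by simp
    qed
  qed
  also have "(\<integral>p. c p + \<beta> * (enn2real (H h p) - enn2real (H (\<lambda>x. - h x) p)) \<partial>?P) =
      (\<integral>p. c p \<partial>?P) + \<beta> * (\<integral>x. h x \<partial>?\<rho>)"
    using c H1 H2 by (simp add: real_lebesgue_integral_def[OF int(2)])
  finally show ?thesis using h_split by simp
qed

section \<open>The switching control law: rate constraint and cost\<close>

theorem theorem7p5:
  fixes Q :: "'x::polish_space \<times> 'u::polish_space \<Rightarrow> 'x measure"
    and c :: "'x \<times> 'u \<Rightarrow> real"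
    and \<mu> \<pi> :: "'x measure"
    and h :: "'x \<Rightarrow> real"
    and \<Phi>_star :: "'x \<Rightarrow> 'u measure"
    and \<beta> C R Rbar \<epsilon> lam :: real
  assumes "compact (UNIV :: 'x set)" and "compact (UNIV :: 'u set)"
    and "Q \<in> markov_kernels" and "weakly_continuous Q"
    and "\<And>p. 0 \<le> c p" and "lower_semicontinuous c" and "bounded (range c)"
    and "C = (SUP p. c p)"
    and "0 < \<beta>" and "\<beta> < 1"
    and "\<mu> \<in> prob_measures" and "\<pi> \<in> prob_measures"
    and "0 \<le> R" and "0 < \<epsilon>"
    and "Rbar = (1 - \<beta>)\<^sup>2 * \<epsilon> / C * R"
    and "integrable \<pi> h" and "0 < lam"
    and "\<Phi>_star \<in> discounted_kernels Q \<beta> \<mu> \<pi> \<inter> info_kernels \<pi> Rbar"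
    and "ereal (1 / (1 - \<beta>) * (\<integral>x. h x \<partial>\<pi>) - (\<integral>x. h x \<partial>\<mu>) + lam) =
         ereal (1 / (1 - \<beta>)) *
           ext_integral (joint_law \<pi> \<Phi>_star) (\<lambda>p. ereal (c p) + ereal \<beta> * kernel_apply Q h p)"
    and "ereal (1 / (1 - \<beta>)) *
           ext_integral (joint_law \<pi> \<Phi>_star) (\<lambda>p. ereal (c p) + ereal \<beta> * kernel_apply Q h p) =
         ereal (1 / (1 - \<beta>)) *
           distortion_rate \<pi> Rbar (\<lambda>p. ereal (c p) + ereal \<beta> * kernel_apply Q h p)"
  shows "(INF \<Phi> \<in> info_control_laws Q \<mu> R. discounted_cost Q c \<beta> \<mu> \<Phi>) \<le>
         ereal (1 / (1 - \<beta>)) *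
           (distortion_rate \<pi> Rbar (\<lambda>p. ereal (c p) + ereal \<beta> * kernel_apply Q h p)
             - ereal (\<integral>x. h x \<partial>\<pi>))
         + ereal (\<integral>x. h x \<partial>\<mu>) + ereal \<epsilon>"
proof -
  note Q = assms(3) and c0 = assms(5) and \<beta> = assms(9,10) and \<mu> = assms(11) and \<pi> = assms(12)
  let ?K = "\<Phi>_star" and ?f = "\<lambda>p. ereal (c p) + ereal \<beta> * kernel_apply Q h p"
  let ?P = "joint_law \<pi> ?K"
  have KD: "?K \<in> discounted_kernels Q \<beta> \<mu> \<pi>" and info: "mutual_info \<pi> ?K \<le> ereal Rbar"
    and K: "?K \<in> markov_kernels"
    using assms(18) by (auto simp: info_kernels_def)
  have c [measurable]: "c \<in> borel_measurable (borel \<Otimes>\<^sub>M borel)"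
    using borel_measurable_lower_semicontinuous[OF assms(6)] by (simp add: borel_prod)
  have cC: "c p \<le> C" for p
    unfolding assms(8) using assms(7) by (intro cSUP_upper bounded_imp_bdd_above) auto
  have C0: "0 \<le> C" using c0[of undefined] cC[of undefined] by linarith
  interpret P: prob_space ?P by (rule joint_law_prob[OF \<pi> K])
  have [measurable_cong]: "sets ?P = sets (borel \<Otimes>\<^sub>M borel)" by (rule joint_law_prob[OF \<pi> K])
  have intc: "integrable ?P c"
    using c0 cC by (intro P.integrable_const_bound[of _ C]) auto
  define L where "L = (\<integral>p. c p \<partial>?P)"

  \<comment> \<open>The assumed equality with a real number rules out the dummy value, and this in
    turn supplies the measurability of \<open>?f\<close>.\<close>
  have "ext_integral ?P ?f \<noteq> \<infinity>"
    using assms(19) \<beta> by auto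
  then have "?f \<in> borel_measurable ?P"
    by (auto simp: ext_integral_def integral_defined_def split: if_splits)
  then have ext: "ext_integral ?P ?f = ereal (L + ((\<integral>x. h x \<partial>\<pi>) - (1 - \<beta>) * (\<integral>x. h x \<partial>\<mu>)))"
    unfolding L_def by (rule ext_integral_cost_to_go[OF Q \<mu> \<pi> \<beta> KD assms(16) intc])
  have "distortion_rate \<pi> Rbar ?f = ext_integral ?P ?f"
    using assms(20) \<beta> by (auto dest: ereal_mult_cancel_left[THEN iffD1])
  then have rhs: "ereal (1 / (1 - \<beta>)) * (distortion_rate \<pi> Rbar ?f - ereal (\<integral>x. h x \<partial>\<pi>))
      + ereal (\<integral>x. h x \<partial>\<mu>) + ereal \<epsilon> = ereal (L / (1 - \<beta>) + \<epsilon>)"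
    using \<beta> by (simp add: ext field_simps)

  have "(\<lambda>t. \<beta> ^ t * C) \<longlonglongrightarrow> 0 * C"
    using \<beta> by (intro tendsto_mult LIMSEQ_power_zero) auto
  then have "eventually (\<lambda>t. \<beta> ^ t * C < (1 - \<beta>) * \<epsilon>) sequentially"
    using \<beta> assms(14) by (intro order_tendstoD(2)) auto
  then have ex: "\<exists>t. \<beta> ^ t * C \<le> (1 - \<beta>) * \<epsilon>"
    by (meson eventually_sequentially less_imp_le order_refl)
  \<comment> \<open>The threshold makes the tail cheap; minimality reverses the inequality at all
    earlier times, which is what the rate constraint needs.\<close>
  define t\<^sub>0 where "t\<^sub>0 = (LEAST t. \<beta> ^ t * C \<le> (1 - \<beta>) * \<epsilon>)"
  have tail: "\<beta> ^ t\<^sub>0 * C \<le> (1 - \<beta>) * \<epsilon>"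
    unfolding t\<^sub>0_def using ex by (rule LeastI_ex)
  have head: "(1 - \<beta>) * \<epsilon> < \<beta> ^ t * C" if "t < t\<^sub>0" for t
    using not_less_Least[OF that[unfolded t\<^sub>0_def]] by simp

  \<comment> \<open>A point mass at an arbitrary control: it matters only that the choice ignores
    the state.\<close>
  define \<kappa> where "\<kappa> = (return borel undefined :: 'u measure)"
  have \<kappa>: "\<kappa> \<in> prob_measures"
    unfolding \<kappa>_def using prob_space_return[of undefined "borel :: 'u measure"]
    by (simp add: space_prob_algebra)
  then have \<kappa>K: "(\<lambda>_::'x. \<kappa>) \<in> markov_kernels" by (rule measurable_const)
  define \<Phi> where "\<Phi> = (\<lambda>t. if t < t\<^sub>0 then ?K else (\<lambda>_. \<kappa>))"
  have \<Phi>: "\<Phi> t \<in> markov_kernels" for t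
    using K \<kappa>K by (simp add: \<Phi>_def)
  let ?m = "marginal_law Q \<mu> \<Phi>" and ?n = "marginal_law Q \<mu> (\<lambda>_. ?K)"
  have m: "?m t \<in> prob_measures" for t using Q \<mu> \<Phi> by (rule marginal_law_prob)
  have m_eq: "?m t = ?n t" if "t \<le> t\<^sub>0" for t
    using that by (intro marginal_law_cong) (auto simp: \<Phi>_def)

  have "mutual_info (?m t) (\<Phi> t) \<le> ereal R" for t
  proof (cases "t < t\<^sub>0")
    case False
    then show ?thesis
      using mutual_info_const[OF m \<kappa>] assms(13) by (simp add: \<Phi>_def)
  next
    case True
    \<comment> \<open>The weight of the state law at time \<open>t\<close> in the discounted
      occupation measure, which \<pi> dominates.\<close>
    let ?\<alpha> = "(1 - \<beta>) * \<beta> ^ t"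
    have \<alpha>: "0 < ?\<alpha>" using \<beta> by simp
    have "mutual_info (?m t) ?K \<le> ereal (Rbar / ?\<alpha>)"
    proof (rule mutual_info_dominated[OF \<pi> m K \<alpha> _ info])
      fix A :: "'x set" assume A [measurable]: "A \<in> sets borel"
      have "ennreal ?\<alpha> * emeasure (?m t) A =
          ennreal (1 - \<beta>) * (ennreal (\<beta> ^ t) * (\<integral>\<^sup>+x. indicator A x \<partial>?n t))"
        using \<beta> True A prob_measuresD(2)[OF m, of t]
        by (simp add: m_eq[symmetric] ennreal_mult mult.assoc)
      \<comment> \<open>A single term is at most the whole sum; the range is \<open>Suc t\<close> so
        that it contains \<open>t\<close>.\<close>
      also have "\<dots> \<le> ennreal (1 - \<beta>) * (\<Sum>s<Suc t. ennreal (\<beta> ^ s) * (\<integral>\<^sup>+x. indicator A x \<partial>?n s))"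
        by (intro mult_left_mono) simp_all
      also have "\<dots> \<le> (\<integral>\<^sup>+x. indicator A x \<partial>\<pi>)"
        by (rule discounted_occupation_le[OF Q \<mu> \<pi> \<beta> KD]) measurable
      also have "\<dots> = emeasure \<pi> A"
        using A prob_measuresD(2)[OF \<pi>] by simp
      finally show "ennreal ?\<alpha> * emeasure (?m t) A \<le> emeasure \<pi> A" .
    qed
    also have "Rbar / ?\<alpha> \<le> R"
    proof -
      \<comment> \<open>If \<open>C = 0\<close>, then \<open>t\<^sub>0 = 0\<close> and no earlier
        time exists. So whenever \<open>Rbar\<close> is used here, the division by \<open>C\<close>
        in it is genuine.\<close>
      have "C \<noteq> 0" using head[OF True] \<beta> assms(14)
        by (metis diff_gt_0_iff_gt less_asym mult_pos_pos mult_zero_right)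
      then have C: "0 < C" using C0 by simp
      \<comment> \<open>Of the two factors \<open>1 - \<beta>\<close> in \<open>Rbar\<close>, one
        cancels against \<open>?\<alpha>\<close>; the other completes the threshold
        \<open>(1 - \<beta>) * \<epsilon>\<close>, which \<open>head\<close> compares with
        \<open>\<beta> ^ t * C\<close>.\<close>
      have "Rbar / ?\<alpha> = ((1 - \<beta>) * \<epsilon>) / (\<beta> ^ t * C) * R"
        unfolding assms(15) using \<beta> C by (simp add: power2_eq_square field_simps)
      also have "\<dots> \<le> 1 * R"
        using head[OF True] C \<beta> assms(13) by (intro mult_right_mono) simp_all
      finally show ?thesis by simp
    qed
    finally show ?thesis using True by (simp add: \<Phi>_def)
  qed
  moreover have "quasistationary \<Phi>"
    unfolding quasistationary_def \<Phi>_def using K \<kappa>K by blast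
  ultimately have law: "\<Phi> \<in> info_control_laws Q \<mu> R"
    by (simp add: info_control_laws_def state_law_eq_marginal_law[OF Q \<mu> \<Phi>])

  define v where "v t = (\<integral>p. c p \<partial>joint_law (?m t) (\<Phi> t))" for t
  have v: "(\<integral>\<^sup>+p. ennreal (c p) \<partial>joint_law (?m t) (\<Phi> t)) = ennreal (v t)" "0 \<le> v t" "v t \<le> C" for t
  proof -
    interpret J: prob_space "joint_law (?m t) (\<Phi> t)" by (rule joint_law_prob[OF m \<Phi>])
    note [measurable_cong] = joint_law_prob(2)[OF m \<Phi>, of t t]
    have i: "integrable (joint_law (?m t) (\<Phi> t)) c"
      using c0 cC by (intro J.integrable_const_bound[of _ C]) auto
    show "(\<integral>\<^sup>+p. ennreal (c p) \<partial>joint_law (?m t) (\<Phi> t)) = ennreal (v t)"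
      unfolding v_def using c0 by (intro nn_integral_eq_integral[OF i]) auto
    show "0 \<le> v t" unfolding v_def using c0 by (intro integral_nonneg_AE) auto
    show "v t \<le> C" unfolding v_def by (rule J.integral_le_const[OF i]) (simp add: cC)
  qed
  have geo: "summable (\<lambda>t. \<beta> ^ t * C)"
    using \<beta> by (intro summable_mult2 summable_geometric) simp
  have vC: "\<beta> ^ t * v t \<le> \<beta> ^ t * C" for t using v(3) \<beta> by (intro mult_left_mono) auto
  have sv: "summable (\<lambda>t. \<beta> ^ t * v t)"
    using v vC \<beta> by (intro summable_comparison_test'[OF geo]) auto
  have "(\<Sum>t. ennreal (\<beta> ^ t) * ennreal (v t)) = ennreal (\<Sum>t. \<beta> ^ t * v t)"
    using v(2) \<beta> sv by (subst suminf_ennreal2[symmetric]) (simp_all add: ennreal_mult)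
  then have "discounted_cost Q c \<beta> \<mu> \<Phi> = ereal (\<Sum>t. \<beta> ^ t * v t)"
    using \<beta> v(2) sv
    by (subst discounted_cost_eq[OF Q \<mu> \<Phi> c c0])
      (simp_all add: v(1) suminf_nonneg)
  moreover have "(\<Sum>t. \<beta> ^ t * v t) \<le> L / (1 - \<beta>) + \<epsilon>"
  proof -
    \<comment> \<open>The occupation bound concerns functions of the state, so the cost is first
      averaged over the control.\<close>
    let ?G = "\<lambda>x. \<integral>\<^sup>+u. ennreal (c (x, u)) \<partial>?K x"
    have [measurable]: "?K \<in> borel \<rightarrow>\<^sub>M subprob_algebra borel"
      using K by (rule measurable_prob_algebraD)
    have G: "?G \<in> borel_measurable borel"
      by (rule nn_integral_measurable_subprob_algebra2[where N=borel]) simp_all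
    have "ennreal ((1 - \<beta>) * (\<Sum>t<t\<^sub>0. \<beta> ^ t * v t)) =
        ennreal (1 - \<beta>) * (\<Sum>t<t\<^sub>0. ennreal (\<beta> ^ t) * ennreal (v t))"
      using \<beta> v(2) by (simp add: ennreal_mult' sum_nonneg flip: sum_ennreal)
    also have "\<dots> = ennreal (1 - \<beta>) * (\<Sum>t<t\<^sub>0. ennreal (\<beta> ^ t) * (\<integral>\<^sup>+x. ?G x \<partial>?n t))"
    proof -
      have "ennreal (v t) = (\<integral>\<^sup>+x. ?G x \<partial>?n t)" if "t < t\<^sub>0" for t
      proof -
        have "\<Phi> t = ?K" "?m t = ?n t" using that by (simp add: \<Phi>_def, intro m_eq less_imp_le)
        then show ?thesis
          using nn_integral_joint_law[OF m[of t] K, of "\<lambda>p. ennreal (c p)"] v(1)[of t] by simp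
      qed
      then show ?thesis by simp
    qed
    also have "\<dots> \<le> (\<integral>\<^sup>+x. ?G x \<partial>\<pi>)"
      by (rule discounted_occupation_le[OF Q \<mu> \<pi> \<beta> KD G])
    also have "\<dots> = (\<integral>\<^sup>+p. ennreal (c p) \<partial>?P)"
      by (rule nn_integral_joint_law[OF \<pi> K, symmetric]) measurable
    also have "\<dots> = ennreal L"
      unfolding L_def using c0 by (intro nn_integral_eq_integral[OF intc]) auto
    finally have "(1 - \<beta>) * (\<Sum>t<t\<^sub>0. \<beta> ^ t * v t) \<le> L"
      unfolding L_def using c0 by (subst (asm) ennreal_le_iff) (auto intro!: integral_nonneg_AE)
    then have 1: "(\<Sum>t<t\<^sub>0. \<beta> ^ t * v t) \<le> L / (1 - \<beta>)"
      using \<beta> by (simp add: pos_le_divide_eq mult.commute)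
    \<comment> \<open>After the switch only \<open>v t \<le> C\<close> is used. The geometric sum
      contributes \<open>1 / (1 - \<beta>)\<close>, which the factor \<open>1 - \<beta>\<close> in
      the threshold for \<open>t\<^sub>0\<close> absorbs.\<close>
    have "(\<Sum>t. \<beta> ^ (t + t\<^sub>0) * v (t + t\<^sub>0)) \<le> (\<Sum>t. \<beta> ^ t * (\<beta> ^ t\<^sub>0 * C))"
      using vC sv \<beta>
      by (intro suminf_le summable_mult2 summable_geometric summable_ignore_initial_segment)
        (auto simp: power_add mult.assoc)
    also have "\<dots> = \<beta> ^ t\<^sub>0 * C / (1 - \<beta>)"
      using \<beta> by (subst suminf_mult2[symmetric]) (auto simp: suminf_geometric summable_geometric)
    also have "\<dots> \<le> \<epsilon>"
      using tail \<beta> by (simp add: pos_divide_le_eq mult.commute)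
    finally show ?thesis
      using 1 suminf_split_initial_segment[OF sv, of t\<^sub>0] by simp
  qed
  ultimately have "discounted_cost Q c \<beta> \<mu> \<Phi> \<le> ereal (L / (1 - \<beta>) + \<epsilon>)" by simp
  then show ?thesis
    unfolding rhs using law by (rule INF_lower2[rotated])
qed

end
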